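(* Let $(e_i)$ be a subsymmetric basis of a Banach space $X$, and let $(e_i^* )\subset X^*$ be its sequence of biorthogonal functionals. Suppose that $(e_i)$ dominates every subsymmetric block basis with respect to $(e_i)$ and that $(e_i^* )$ dominates every subsymmetric block basis with respect to $(e_i^* )$. Then $(e_i)$ is equivalent to the unit vector basis of $c_0$ or of $\ell_p$ for some $1\le p<\infty$.
   Context: Basic sequences $(x_j)$ and $(y_j)$ are equivalent if, for all scalars $(a_j)$, $\sum_j a_jx_j$ converges if and only if $\sum_j a_jy_j$ converges. A basic sequence is subsymmetric if it is unconditional and equivalent to each of its subsequences. A basic sequence $(x_n)$ dominates a basic sequence $(y_n)$ if there is a bounded linear operator $S$ from the closed linear span of $(x_n)$ to the closed linear span of $(y_n)$ with $S(x_n)=y_n$ for all $n$. A block basis with respect to a basic sequence $(x_n)$ is a sequence $(y_n)$ of non-zero vectors of the form $y_n=\sum_{k=p_n+1}^{p_{n+1}}a_kx_k$, where $p_1<p_2<\cdots$ is an increasing sequence of natural numbers. *)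

theory Defs
  imports "HOL-Analysis.Analysis"
begin

text \<open>
  Scalars range over a type \<open>'k\<close> of sort \<open>{real_normed_field, euclidean_space}\<close>. A finite-dimensional
  real division algebra that is commutative and has a multiplicative norm is isometrically the reals
  or the complex numbers, so this covers exactly the real and the complex case; both \<open>real\<close> and
  \<open>complex\<close> are instances. Since the class \<open>banach\<close> only provides a real scalar multiplication,
  the \<open>'k\<close>-scalar multiplication is an explicit parameter.
\<close>

definition normed_scaling :: "('k::real_normed_field \<Rightarrow> 'a::real_normed_vector \<Rightarrow> 'a) \<Rightarrow> bool" where
  "normed_scaling s \<longleftrightarrow> vector_space s \<and> (\<forall>r x. s (of_real r) x = r *\<^sub>R x)
     \<and> (\<forall>c x. norm (s c x) = norm c * norm x)"

definition closed_span ::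
    "('k::real_normed_field \<Rightarrow> 'a::real_normed_vector \<Rightarrow> 'a) \<Rightarrow> (nat \<Rightarrow> 'a) \<Rightarrow> 'a set" where
  "closed_span s x = closure (module.span s (range x))"

definition schauder_basis ::
    "('k::real_normed_field \<Rightarrow> 'a::real_normed_vector \<Rightarrow> 'a) \<Rightarrow> (nat \<Rightarrow> 'a) \<Rightarrow> bool" where
  "schauder_basis s x \<longleftrightarrow> (\<forall>v. \<exists>!a. (\<lambda>n. s (a n) (x n)) sums v)"

definition basic_sequence ::
    "('k::real_normed_field \<Rightarrow> 'a::real_normed_vector \<Rightarrow> 'a) \<Rightarrow> (nat \<Rightarrow> 'a) \<Rightarrow> bool" where
  "basic_sequence s x \<longleftrightarrow> (\<forall>v\<in>closed_span s x. \<exists>!a. (\<lambda>n. s (a n) (x n)) sums v)"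

text \<open>
  Below, \<open>summable\<close> is convergence of the series in the given order, whereas \<open>summable_on UNIV\<close> is
  convergence of the net of all finite partial sums, i.e. unconditional convergence.
\<close>

definition unconditional ::
    "('k::real_normed_field \<Rightarrow> 'a::real_normed_vector \<Rightarrow> 'a) \<Rightarrow> (nat \<Rightarrow> 'a) \<Rightarrow> bool" where
  "unconditional s x \<longleftrightarrow> basic_sequence s x \<and>
     (\<forall>a. summable (\<lambda>n. s (a n) (x n)) \<longrightarrow> (\<lambda>n. s (a n) (x n)) summable_on UNIV)"

definition equivalent_sequences ::
    "('k::real_normed_field \<Rightarrow> 'a::real_normed_vector \<Rightarrow> 'a) \<Rightarrow> (nat \<Rightarrow> 'a) \<Rightarrow>
     ('k \<Rightarrow> 'b::real_normed_vector \<Rightarrow> 'b) \<Rightarrow> (nat \<Rightarrow> 'b) \<Rightarrow> bool" where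
  "equivalent_sequences s x t y \<longleftrightarrow>
     (\<forall>a. summable (\<lambda>n. s (a n) (x n)) \<longleftrightarrow> summable (\<lambda>n. t (a n) (y n)))"

definition subsymmetric ::
    "('k::real_normed_field \<Rightarrow> 'a::real_normed_vector \<Rightarrow> 'a) \<Rightarrow> (nat \<Rightarrow> 'a) \<Rightarrow> bool" where
  "subsymmetric s x \<longleftrightarrow> basic_sequence s x \<and> unconditional s x \<and>
     (\<forall>r::nat \<Rightarrow> nat. strict_mono r \<longrightarrow> equivalent_sequences s x s (x \<circ> r))"

definition dominates ::
    "('k::real_normed_field \<Rightarrow> 'a::real_normed_vector \<Rightarrow> 'a) \<Rightarrow> (nat \<Rightarrow> 'a) \<Rightarrow>
     ('k \<Rightarrow> 'b::real_normed_vector \<Rightarrow> 'b) \<Rightarrow> (nat \<Rightarrow> 'b) \<Rightarrow> bool" where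
  "dominates s x t y \<longleftrightarrow>
     (\<exists>S. (\<forall>v\<in>closed_span s x. S v \<in> closed_span t y)
        \<and> (\<forall>v\<in>closed_span s x. \<forall>w\<in>closed_span s x. S (v + w) = S v + S w)
        \<and> (\<forall>c. \<forall>v\<in>closed_span s x. S (s c v) = t c (S v))
        \<and> (\<exists>C. \<forall>v\<in>closed_span s x. norm (S v) \<le> C * norm v)
        \<and> (\<forall>n. S (x n) = y n))"

text \<open>Indices start at 0, so a block \<open>p\<^sub>n + 1, \<dots>, p\<^sub>n\<^sub>+\<^sub>1\<close> of 1-based indices becomes \<open>{p n..<p (Suc n)}\<close>.\<close>

definition block_basis ::
    "('k::real_normed_field \<Rightarrow> 'a::real_normed_vector \<Rightarrow> 'a) \<Rightarrow> (nat \<Rightarrow> 'a) \<Rightarrow> (nat \<Rightarrow> 'a) \<Rightarrow> bool" where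
  "block_basis s x y \<longleftrightarrow>
     (\<exists>(p::nat \<Rightarrow> nat) a. strict_mono p \<and>
        (\<forall>n. y n \<noteq> 0 \<and> y n = (\<Sum>k\<in>{p n..<p (Suc n)}. s (a k) (x k))))"

text \<open>
  The dual space is the set of \<open>'k\<close>-linear elements of the Banach space \<open>'a \<Rightarrow>\<^sub>L 'k\<close> of bounded
  real-linear maps, with the operator norm. It is a closed \<open>'k\<close>-subspace under \<open>dual_scale\<close>, so
  basic sequences, block bases and closed spans of functionals may be formed in the larger space.
\<close>

definition dual_scale ::
    "'k::real_normed_field \<Rightarrow> ('a::real_normed_vector \<Rightarrow>\<^sub>L 'k) \<Rightarrow> ('a \<Rightarrow>\<^sub>L 'k)" where
  "dual_scale c f = blinfun_mult_right c o\<^sub>L f"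

definition dual_space ::
    "('k::real_normed_field \<Rightarrow> 'a::real_normed_vector \<Rightarrow> 'a) \<Rightarrow> ('a \<Rightarrow>\<^sub>L 'k) set" where
  "dual_space s = {f. \<forall>c x. blinfun_apply f (s c x) = c * blinfun_apply f x}"

lemma blinfun_apply_dual_scale [simp]:
  "blinfun_apply (dual_scale c f) x = c * blinfun_apply f x"
  by (simp add: dual_scale_def)

lemma normed_scaling_dual_scale:
  "normed_scaling (dual_scale :: 'k::real_normed_field \<Rightarrow> ('a::real_normed_vector \<Rightarrow>\<^sub>L 'k) \<Rightarrow> _)"
proof -
  have le: "norm (dual_scale c f) \<le> norm c * norm f" for c :: 'k and f :: "'a \<Rightarrow>\<^sub>L 'k"
  proof (rule norm_blinfun_bound)
    fix x
    show "norm (blinfun_apply (dual_scale c f) x) \<le> norm c * norm f * norm x"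
      using mult_left_mono[OF norm_blinfun[of f x], of "norm c"] by (simp add: norm_mult mult.assoc)
  qed simp
  have "norm (dual_scale c f) = norm c * norm f" for c :: 'k and f :: "'a \<Rightarrow>\<^sub>L 'k"
  proof (cases "c = 0")
    case True
    then show ?thesis using le[of c f] by simp
  next
    case False
    have "dual_scale (inverse c) (dual_scale c f) = f"
      using False by (intro blinfun_eqI) simp
    then have "norm f \<le> inverse (norm c) * norm (dual_scale c f)"
      using le[of "inverse c" "dual_scale c f"] by (simp add: norm_inverse)
    then have "norm c * norm f \<le> norm (dual_scale c f)"
      using False by (simp add: field_simps)
    then show ?thesis using le[of c f] by simp
  qed
  moreover have "vector_space (dual_scale :: 'k \<Rightarrow> ('a \<Rightarrow>\<^sub>L 'k) \<Rightarrow> _)"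
    by standard (auto intro!: blinfun_eqI simp: blinfun.bilinear_simps algebra_simps)
  moreover have "dual_scale (of_real r) f = r *\<^sub>R f" for r and f :: "'a \<Rightarrow>\<^sub>L 'k"
    by (intro blinfun_eqI) (simp add: blinfun.bilinear_simps scaleR_conv_of_real)
  ultimately show ?thesis by (simp add: normed_scaling_def)
qed

definition unit_vec :: "nat \<Rightarrow> nat \<Rightarrow> 'k::real_normed_field" where
  "unit_vec j = (\<lambda>i. if i = j then 1 else 0)"

definition c0_space :: "(nat \<Rightarrow> 'k::real_normed_field) set" where
  "c0_space = {z. z \<longlonglongrightarrow> 0}"

definition c0_norm :: "(nat \<Rightarrow> 'k::real_normed_field) \<Rightarrow> real" where
  "c0_norm z = (SUP i. norm (z i))"

definition lp_space :: "real \<Rightarrow> (nat \<Rightarrow> 'k::real_normed_field) set" where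
  "lp_space p = {z. summable (\<lambda>i. norm (z i) powr p)}"

definition lp_norm :: "real \<Rightarrow> (nat \<Rightarrow> 'k::real_normed_field) \<Rightarrow> real" where
  "lp_norm p z = (\<Sum>i. norm (z i) powr p) powr (1 / p)"

text \<open>
  Convergence of the series \<open>\<Sum>j. a j * unit_vec j\<close> in the sequence space with carrier \<open>Z\<close> and
  norm \<open>N\<close>: the \<open>N\<close>-distance of the partial sums to some \<open>z \<in> Z\<close> tends to 0.
\<close>

definition unit_vec_series_converges ::
    "(nat \<Rightarrow> 'k::real_normed_field) set \<Rightarrow> ((nat \<Rightarrow> 'k) \<Rightarrow> real) \<Rightarrow> (nat \<Rightarrow> 'k) \<Rightarrow> bool" where
  "unit_vec_series_converges Z N a \<longleftrightarrow>
     (\<exists>z\<in>Z. (\<lambda>n. N (\<lambda>i. (\<Sum>j<n. a j * unit_vec j i) - z i)) \<longlonglongrightarrow> 0)"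

definition equivalent_to_unit_vec_basis ::
    "('k::real_normed_field \<Rightarrow> 'a::real_normed_vector \<Rightarrow> 'a) \<Rightarrow> (nat \<Rightarrow> 'a) \<Rightarrow>
     (nat \<Rightarrow> 'k) set \<Rightarrow> ((nat \<Rightarrow> 'k) \<Rightarrow> real) \<Rightarrow> bool" where
  "equivalent_to_unit_vec_basis s x Z N \<longleftrightarrow>
     (\<forall>a. summable (\<lambda>n. s (a n) (x n)) \<longleftrightarrow> unit_vec_series_converges Z N a)"

end

theory Submission
  imports Defs
begin

text \<open>
  For finite coefficient lists let \<open>tensor cs as\<close> consist of consecutive copies of \<open>as\<close>, multiplied
  by the successive entries of \<open>cs\<close>; it lists the coordinates of the vector with coefficients \<open>cs\<close> with
  respect to the block basis of consecutive copies of \<open>as\<close>.  The proof shows that the norm of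
  \<open>tensor cs as\<close> is, up to a constant, the product of the norms of \<open>cs\<close> and \<open>as\<close>, and that such a
  multiplicative norm is equivalent to the norm of \<open>c\<^sub>0\<close> or of an \<open>\<ell>\<^sub>p\<close>.

  A gliding hump argument and uniform boundedness turn subsymmetry into a quantitative statement
  (\<open>spreading_with_dual\<close>): deleting coefficients, shrinking them and inserting zeros increases the
  norm at most by a constant factor.  In this form the property passes to the biorthogonal
  functionals by duality.

  For each fixed \<open>as\<close>, the copies of \<open>as\<close> form a subsymmetric block basis, so domination yields
  \<open>norm (tensor cs as) \<le> C * norm cs * norm as\<close> with \<open>C\<close> depending on \<open>as\<close>.  If there were no uniform
  \<open>C\<close>, then lists \<open>A 0, A 1, \<dots>\<close> that violate the inequality ever more could be scaled to norm
  \<open>(1/2) ^ k\<close> and strung together.  The blocks that carry copies of \<open>A 0 @ \<dots> @ A j\<close> form a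
  subsymmetric block basis (\<open>subsymmetric_copy\<close>), because the tails are small, and the basis cannot
  dominate it.  This proves \<open>tensor_upper_bound\<close>, for the basis as well as for its functionals.
  Testing \<open>tensor cs as\<close> against the product of norming functionals of \<open>cs\<close> and \<open>as\<close> converts the upper
  bound for the functionals into the lower bound for the basis (\<open>tensor_lower_bound\<close>).

  Consequently the norm of \<open>n\<close> ones is almost multiplicative in \<open>n\<close>.  It is also almost increasing,
  and hence comparable to \<open>n powr \<theta>\<close> for some \<open>\<theta>\<close> between 0 and 1.  If \<open>\<theta> = 0\<close>, these norms are bounded, and unconditionality
  makes the basis equivalent to that of \<open>c\<^sub>0\<close>.  Otherwise let \<open>p = 1 / \<theta>\<close>.  A list with few distinct
  entries is a short sum of multiples of indicators, so its norm agrees with its \<open>\<ell>\<^sub>p\<close> norm up to a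
  multiple of the number of these entries.  The \<open>N\<close>-th tensor power of a list of powers of 2 has a number of distinct
  entries that is at most linear in \<open>N\<close>; taking \<open>N\<close>-th roots removes this number, and what remains is a
  comparison with a constant independent of the list (\<open>c0_or_lp\<close>).
\<close>

section \<open>Scalar multiplication and multipliers\<close>

locale scaled_space =
  fixes s :: "'k::{real_normed_field, euclidean_space} \<Rightarrow> 'b::real_normed_vector \<Rightarrow> 'b"
  assumes scaling: "normed_scaling s"
begin

sublocale vs: vector_space s
  using scaling by (simp add: normed_scaling_def)

lemma norm_scale: "norm (s c v) = norm c * norm v"
  using scaling by (simp add: normed_scaling_def)

lemma scale_of_real: "s (of_real r) v = r *\<^sub>R v"
  using scaling by (simp add: normed_scaling_def)

sublocale bil: bounded_bilinear s
proof
  show "s (r *\<^sub>R a) b = r *\<^sub>R s a b" for r a b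
    by (metis scale_of_real scaleR_conv_of_real vs.scale_scale)
  show "s a (r *\<^sub>R b) = r *\<^sub>R s a b" for r a b
    by (metis scale_of_real vs.scale_left_commute)
  show "\<exists>K. \<forall>a b. norm (s a b) \<le> norm a * norm b * K"
    by (intro exI[of _ 1]) (simp add: norm_scale)
qed (simp_all add: vs.scale_left_distrib vs.scale_right_distrib)

end

text \<open>
  The norm of \<open>w + (\<Sum>i. t i *\<^sub>R v i)\<close> is convex in each \<open>t i\<close> separately, so on a cube it is largest
  at a vertex.
\<close>

lemma norm_cube_le:
  fixes v :: "'i \<Rightarrow> 'b::real_normed_vector"
  assumes "finite I" and "\<And>i. i \<in> I \<Longrightarrow> 0 \<le> t i \<and> t i \<le> (1::real)"
    and "\<And>G. G \<subseteq> I \<Longrightarrow> norm (w + sum v G) \<le> B"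
  shows "norm (w + (\<Sum>i\<in>I. t i *\<^sub>R v i)) \<le> B"
  using assms
proof (induction I arbitrary: w rule: finite_induct)
  case empty
  then show ?case by force
next
  case (insert j I)
  define u where "u = w + (\<Sum>i\<in>I. t i *\<^sub>R v i)"
  have 0: "norm u \<le> B"
    unfolding u_def by (rule insert.IH) (use insert.prems in auto)
  have "norm ((w + v j) + (\<Sum>i\<in>I. t i *\<^sub>R v i)) \<le> B"
  proof (rule insert.IH)
    fix G assume G: "G \<subseteq> I"
    then have "finite G" "j \<notin> G"
      using insert.hyps finite_subset by auto
    then have "w + v j + sum v G = w + sum v (insert j G)"
      by (simp add: add.assoc)
    moreover have "insert j G \<subseteq> insert j I"
      using G by auto
    ultimately show "norm (w + v j + sum v G) \<le> B"
      using insert.prems(2)[of "insert j G"] by metis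
  qed (use insert.prems in auto)
  then have 1: "norm (u + v j) \<le> B"
    by (simp add: u_def algebra_simps)
  have "w + (\<Sum>i\<in>insert j I. t i *\<^sub>R v i) = (1 - t j) *\<^sub>R u + t j *\<^sub>R (u + v j)"
    using insert.hyps by (simp add: u_def algebra_simps)
  also have "norm \<dots> \<le> (1 - t j) * B + t j * B"
    using insert.prems(1)[of j] 0 1
    by (intro order_trans[OF norm_triangle_ineq] add_mono) (auto intro!: mult_left_mono)
  finally show ?case by (simp add: algebra_simps)
qed

text \<open>
  A scalar multiplier is split into its real coordinates, and a real \<open>t \<in> [-1, 1]\<close> into
  \<open>2 * ((t + 1) / 2) - 1\<close>; this is where the constant comes from.
\<close>

lemma (in scaled_space) norm_multiplier_le:
  fixes v :: "'i \<Rightarrow> 'b"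
  assumes I: "finite I" and \<beta>: "\<And>i. i \<in> I \<Longrightarrow> norm (\<beta> i) \<le> 1"
    and B: "\<And>G. G \<subseteq> I \<Longrightarrow> norm (sum v G) \<le> B"
  shows "norm (\<Sum>i\<in>I. s (\<beta> i) (v i)) \<le> 3 * real DIM('k) * B"
proof -
  have real_case: "norm (\<Sum>i\<in>I. t i *\<^sub>R v i) \<le> 3 * B" if t: "\<And>i. i \<in> I \<Longrightarrow> \<bar>t i\<bar> \<le> 1" for t :: "'i \<Rightarrow> real"
  proof -
    have "norm (0 + (\<Sum>i\<in>I. ((t i + 1) / 2) *\<^sub>R v i)) \<le> B"
      using t by (intro norm_cube_le I) (auto simp: abs_le_iff B, smt (verit) t abs_le_iff)
    moreover have "2 *\<^sub>R ((t i + 1) / 2) *\<^sub>R v i - v i = t i *\<^sub>R v i" for i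
    proof -
      have "2 * ((t i + 1) / 2) = t i + 1" by simp
      then show ?thesis by (simp only: scaleR_scaleR scaleR_add_left) simp
    qed
    then have "(\<Sum>i\<in>I. t i *\<^sub>R v i) = 2 *\<^sub>R (\<Sum>i\<in>I. ((t i + 1) / 2) *\<^sub>R v i) - sum v I"
      unfolding scaleR_sum_right sum_subtractf[symmetric] by simp
    ultimately show ?thesis
      using B[of I] norm_triangle_ineq4[of "2 *\<^sub>R (\<Sum>i\<in>I. ((t i + 1) / 2) *\<^sub>R v i)" "sum v I"] by simp
  qed
  have "s (\<beta> i) (v i) = (\<Sum>u\<in>Basis. s u ((\<beta> i \<bullet> u) *\<^sub>R v i))" for i
  proof -
    have "s (\<beta> i) (v i) = s (\<Sum>u\<in>Basis. (\<beta> i \<bullet> u) *\<^sub>R u) (v i)"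
      by (simp only: euclidean_representation)
    also have "\<dots> = (\<Sum>u\<in>Basis. s ((\<beta> i \<bullet> u) *\<^sub>R u) (v i))"
      by (rule bil.sum_left)
    finally show ?thesis
      by (simp only: bil.scaleR_left bil.scaleR_right)
  qed
  then have "(\<Sum>i\<in>I. s (\<beta> i) (v i)) = (\<Sum>u\<in>Basis. s u (\<Sum>i\<in>I. (\<beta> i \<bullet> u) *\<^sub>R v i))"
    by (simp only: bil.sum_right) (rule sum.swap)
  also have "norm \<dots> \<le> (\<Sum>u\<in>(Basis::'k set). 3 * B)"
  proof (rule sum_norm_le)
    fix u :: 'k assume u: "u \<in> Basis"
    have "norm (\<Sum>i\<in>I. (\<beta> i \<bullet> u) *\<^sub>R v i) \<le> 3 * B"
      using \<beta> Basis_le_norm[OF u] by (intro real_case) (meson order_trans)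
    then show "norm (s u (\<Sum>i\<in>I. (\<beta> i \<bullet> u) *\<^sub>R v i)) \<le> 3 * B"
      using u by (simp add: norm_scale)
  qed
  finally show ?thesis by (simp add: mult_ac)
qed

section \<open>Uniform boundedness\<close>

text \<open>
  By Baire's theorem, one of the closed sets of vectors on which all maps are bounded by \<open>n\<close>
  contains a ball.
\<close>

theorem uniform_boundedness:
  fixes T :: "'i \<Rightarrow> 'a::banach \<Rightarrow> 'b::real_normed_vector"
  assumes lin: "\<And>i. i \<in> A \<Longrightarrow> bounded_linear (T i)"
    and bdd: "\<And>v. \<exists>B. \<forall>i\<in>A. norm (T i v) \<le> B"
  shows "\<exists>K. \<forall>i\<in>A. \<forall>v. norm (T i v) \<le> K * norm v"
proof -
  define F where "F n = (\<Inter>i\<in>A. {v. norm (T i v) \<le> real n})" for n :: nat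
  have F_closed: "closed (F n)" for n
    unfolding F_def
    by (intro closed_INT ballI closed_Collect_le continuous_on_norm continuous_on_const
        linear_continuous_on lin)
  have "(\<Union>n. F n) = UNIV"
  proof (intro set_eqI iffI UNIV_I)
    fix v
    obtain B where "\<forall>i\<in>A. norm (T i v) \<le> B" using bdd by blast
    moreover obtain n :: nat where "B \<le> real n" using real_arch_simple by blast
    ultimately have "v \<in> F n"
      unfolding F_def by (auto intro: order_trans)
    then show "v \<in> (\<Union>n. F n)" by blast
  qed
  have "\<exists>n. interior (F n) \<noteq> {}"
  proof (rule ccontr)
    assume "\<nexists>n. interior (F n) \<noteq> {}"
    then have "euclidean interior_of \<Union>(range F) = {}"
      by (intro Baire_category_alt) (auto simp: completely_metrizable_space_euclidean F_closed)
    with \<open>(\<Union>n. F n) = UNIV\<close> show False by simp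
  qed
  then obtain n x r where r: "r > 0" "cball x r \<subseteq> F n"
    by (meson ex_in_conv mem_interior_cball)
  have "norm (T i v) \<le> (2 * real n / r) * norm v" if i: "i \<in> A" for i v
  proof (cases "v = 0")
    case True
    then show ?thesis using lin[OF i] by (simp add: linear_simps)
  next
    case False
    interpret bounded_linear "T i" by (rule lin[OF i])
    define w where "w = (r / norm v) *\<^sub>R v"
    have "norm w = r" using False r by (simp add: w_def)
    then have "x + w \<in> F n" "x \<in> F n"
      using r(2) by (auto simp: subset_iff dist_norm r(1) less_imp_le)
    then have "norm (T i (x + w)) \<le> n" "norm (T i x) \<le> n"
      using i by (auto simp: F_def)
    then have "norm (T i w) \<le> 2 * real n"
      using norm_triangle_ineq4[of "T i (x + w)" "T i x"] by (simp add: add)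
    then show ?thesis
      using False r by (simp add: w_def scaleR field_simps)
  qed
  then show ?thesis by blast
qed

section \<open>Subsymmetric bases\<close>

locale scaled_banach = scaled_space s
  for s :: "'k::{real_normed_field, euclidean_space} \<Rightarrow> 'b::banach \<Rightarrow> 'b"

lemma strict_mono_choice:
  fixes P :: "nat \<Rightarrow> nat \<Rightarrow> bool"
  assumes "\<And>i m. \<exists>j>m. P i j"
  obtains r where "strict_mono r" "\<And>i. P i (r i)"
proof -
  have "\<exists>r. \<forall>i. P i (r i) \<and> r i < r (Suc i)"
    by (rule dependent_nat_choice) (use assms in blast)+
  then show ?thesis
    using that by (auto simp: strict_mono_Suc_iff)
qed

lemma bounded_if_eventually_bounded:
  fixes f :: "nat \<Rightarrow> real"
  assumes "\<And>j. f j \<ge> 0" "\<And>j. j > m \<Longrightarrow> f j \<le> C" 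
  obtains U where "\<And>j. f j \<le> U" "U > 0"
proof
  fix j
  show "f j \<le> \<bar>C\<bar> + 1 + sum f {..m}"
  proof (cases "j > m")
    case True
    then show ?thesis using assms(2)[of j] sum_nonneg[of "{..m}" f] assms(1) by force
  next
    case False
    then show ?thesis using member_le_sum[of j "{..m}" f] assms(1) by force
  qed
  show "\<bar>C\<bar> + 1 + sum f {..m} > 0" using sum_nonneg[of "{..m}" f] assms(1) by force
qed

context scaled_banach
begin

lemma summable_norm_le_power:
  assumes "\<And>n. norm (f n) \<le> C * (1/2) ^ n"
  shows "summable (f :: nat \<Rightarrow> 'b)"
  by (rule summable_comparison_test'[of "\<lambda>n. C * (1/2) ^ n" 0]) (use assms in auto)

text \<open>
  If the norms were unbounded, then a fast growing subsequence would turn an absolutely convergent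
  series into a divergent one; if they were not bounded away from 0, then a fast decreasing
  subsequence would turn a divergent series into an absolutely convergent one.
\<close>

lemma subsymmetric_seminormalized:
  assumes sub: "subsymmetric s e" and nz: "\<And>n. e n \<noteq> 0"
  obtains L U where "0 < L" "0 < U" "\<And>n. L \<le> norm (e n)" "\<And>n. norm (e n) \<le> U"
proof -
  have eqv: "summable (\<lambda>n. s (a n) (e n)) \<longleftrightarrow> summable (\<lambda>n. s (a n) (e (r n)))" if "strict_mono r" for r a
    using sub that by (simp add: subsymmetric_def equivalent_sequences_def)
  \<comment> \<open>One argument serves both bounds: the unbounded quantity is the norm or its reciprocal.\<close>
  have no_growth: False
    if r: "strict_mono r" and gr: "\<And>i. 2 ^ i \<le> f (r i) / f i" and f: "(\<forall>i. f i = norm (e i)) \<or> (\<forall>i. f i = 1 / norm (e i))"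
    for r :: "nat \<Rightarrow> nat" and f :: "nat \<Rightarrow> real"
    using f
  proof
    assume f: "\<forall>i. f i = norm (e i)"
    define a where "a i = (of_real (1 / norm (e (r i))) :: 'k)" for i
    have "norm (s (a i) (e i)) \<le> 1 * (1/2) ^ i" for i
      using gr[of i] nz[of i] nz[of "r i"] by (simp add: f a_def norm_scale norm_divide field_simps)
    then have "summable (\<lambda>i. s (a i) (e (r i)))"
      using eqv[OF r] by (meson summable_norm_le_power)
    then have "(\<lambda>i. norm (s (a i) (e (r i)))) \<longlonglongrightarrow> 0"
      by (intro tendsto_norm_zero summable_LIMSEQ_zero)
    moreover have "norm (s (a i) (e (r i))) = 1" for i
      using nz[of "r i"] by (simp add: a_def norm_scale norm_divide)
    ultimately show False by (simp add: LIMSEQ_const_iff)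
  next
    assume f: "\<forall>i. f i = 1 / norm (e i)"
    define a where "a i = (of_real (1 / norm (e i)) :: 'k)" for i
    have "norm (s (a i) (e (r i))) \<le> 1 * (1/2) ^ i" for i
      using gr[of i] nz[of i] nz[of "r i"] by (simp add: f a_def norm_scale norm_divide field_simps)
    then have "summable (\<lambda>i. s (a i) (e i))"
      using eqv[OF r] by (meson summable_norm_le_power)
    then have "(\<lambda>i. norm (s (a i) (e i))) \<longlonglongrightarrow> 0"
      by (intro tendsto_norm_zero summable_LIMSEQ_zero)
    moreover have "norm (s (a i) (e i)) = 1" for i
      using nz[of i] by (simp add: a_def norm_scale norm_divide)
    ultimately show False by (simp add: LIMSEQ_const_iff)
  qed
  have bdd: "\<exists>U>0. \<forall>i. f i \<le> U" if f: "(\<forall>i. f i = norm (e i)) \<or> (\<forall>i. f i = 1 / norm (e i))" for f :: "nat \<Rightarrow> real"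
  proof (rule ccontr)
    assume unbdd: "\<nexists>U. U > 0 \<and> (\<forall>i. f i \<le> U)"
    have pos: "f i > 0" for i using f nz by auto
    have "\<exists>j>m. f j > C" for m C
    proof (rule ccontr)
      assume "\<not> ?thesis"
      then have "\<And>j. j > m \<Longrightarrow> f j \<le> C" using leI by blast
      then obtain U where "\<And>j. f j \<le> U" "U > 0"
        using bounded_if_eventually_bounded[of f m C] pos less_imp_le by metis
      with unbdd show False by blast
    qed
    then obtain r where r: "strict_mono r" "\<And>i. f (r i) > 2 ^ i * f i"
      using strict_mono_choice[of "\<lambda>i j. f j > 2 ^ i * f i"] by metis
    have "2 ^ i \<le> f (r i) / f i" for i
      using r(2)[of i] pos[of i] by (simp add: field_simps)
    then show False using no_growth r(1) f by blast
  qed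
  obtain U where U: "U > 0" "\<And>i. norm (e i) \<le> U" using bdd[of "\<lambda>i. norm (e i)"] by auto
  obtain V where V: "V > 0" "\<And>i. 1 / norm (e i) \<le> V" using bdd[of "\<lambda>i. 1 / norm (e i)"] by auto
  have "1 / V \<le> norm (e i)" for i
    using V(2)[of i] V(1) nz[of i] by (simp add: field_simps)
  then show ?thesis using that[of "1 / V" U] U V by simp
qed

text \<open>
  Gliding hump: were these sums unbounded, then dropping finitely many terms from such a sum would
  still leave it large, with all its indices beyond any given bound.  Stringing together infinitely
  many such pieces gives two increasing sequences of indices, \<open>q\<close> and \<open>\<phi> \<circ> q\<close>, for which the series
  of \<open>a (\<phi> (q i))\<close> times \<open>e (q i)\<close> diverges.  But it converges: by unconditionality along \<open>\<phi> \<circ> q\<close>,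
  then by subsymmetry along \<open>q\<close>.
\<close>

lemma subsymmetric_spread_bounded:
  assumes sub: "subsymmetric s e" and nz: "\<And>n. e n \<noteq> 0"
    and conv: "summable (\<lambda>n. s (a n) (e n))"
  shows "\<exists>B. \<forall>I \<phi>. finite I \<longrightarrow> strict_mono_on I \<phi> \<longrightarrow> norm (\<Sum>i\<in>I. s (a (\<phi> i)) (e i)) \<le> B"
proof (rule ccontr)
  assume unbdd: "\<not> ?thesis"
  obtain L U where LU: "0 < L" "0 < U" "\<And>n. L \<le> norm (e n)" "\<And>n. norm (e n) \<le> U"
    using subsymmetric_seminormalized[OF sub nz] by blast
  have "(\<lambda>n. norm (s (a n) (e n))) \<longlonglongrightarrow> 0"
    by (intro tendsto_norm_zero summable_LIMSEQ_zero conv)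
  then obtain A where A: "\<And>n. norm (s (a n) (e n)) \<le> A"
    using convergent_imp_Bseq[OF convergentI] by (fastforce simp: Bseq_def)
  have term_le: "norm (s (a m) (e n)) \<le> (A / L) * U" for m n
  proof -
    have "norm (a m) * L \<le> A"
      using A[of m] LU(3)[of m] by (smt (verit) norm_scale mult_left_mono norm_ge_zero)
    then have "norm (a m) \<le> A / L" using LU by (simp add: field_simps)
    then show ?thesis unfolding norm_scale using LU(2,4) by (intro mult_mono) (auto intro: order_trans[OF norm_ge_zero])
  qed
  have piece: "\<exists>I \<phi> R'. R < R' \<and> finite I \<and> strict_mono_on I \<phi> \<and>
      (\<forall>i\<in>I. R \<le> i \<and> i < R' \<and> R \<le> \<phi> i \<and> \<phi> i < R') \<and> norm (\<Sum>i\<in>I. s (a (\<phi> i)) (e i)) \<ge> 1" for R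
  proof -
    define M where "M = (A / L) * U"
    have M: "M \<ge> 0" using term_le[of 0 0] norm_ge_zero order_trans unfolding M_def by blast
    obtain I \<phi> where I: "finite I" "strict_mono_on I \<phi>"
      and big: "norm (\<Sum>i\<in>I. s (a (\<phi> i)) (e i)) > 1 + real (2 * R) * M"
    proof -
      from unbdd have "\<not> (\<forall>I \<phi>. finite I \<longrightarrow> strict_mono_on I \<phi> \<longrightarrow>
          norm (\<Sum>i\<in>I. s (a (\<phi> i)) (e i)) \<le> 1 + real (2 * R) * M)"
        by (rule contrapos_nn) (rule exI)
      then show thesis using that by (auto simp: not_le)
    qed
    define D where "D = {i\<in>I. i < R} \<union> {i\<in>I. \<phi> i < R}"
    have "card {i\<in>I. i < R} \<le> R"
      using card_mono[of "{..<R}" "{i\<in>I. i < R}"] by auto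
    moreover have "card {i\<in>I. \<phi> i < R} \<le> R"
    proof -
      have "inj_on \<phi> {i\<in>I. \<phi> i < R}"
        by (rule inj_on_subset[OF strict_mono_on_imp_inj_on[OF I(2)]]) auto
      then show ?thesis
        using card_inj_on_le[of \<phi> "{i\<in>I. \<phi> i < R}" "{..<R}"] by auto
    qed
    ultimately have cardD: "card D \<le> 2 * R"
      unfolding D_def by (intro order_trans[OF card_Un_le]) simp
    have "norm (\<Sum>i\<in>D. s (a (\<phi> i)) (e i)) \<le> real (card D) * M"
      using term_le unfolding M_def by (intro sum_norm_bound) auto
    also have "\<dots> \<le> real (2 * R) * M" using cardD M by (intro mult_right_mono) (simp_all flip: of_nat_le_iff)
    finally have small: "norm (\<Sum>i\<in>D. s (a (\<phi> i)) (e i)) \<le> real (2 * R) * M" .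
    have "D \<subseteq> I" by (auto simp: D_def)
    then have split: "(\<Sum>i\<in>I. s (a (\<phi> i)) (e i)) = (\<Sum>i\<in>I-D. s (a (\<phi> i)) (e i)) + (\<Sum>i\<in>D. s (a (\<phi> i)) (e i))"
      using I(1) by (simp add: sum.subset_diff)
    have "norm (\<Sum>i\<in>I-D. s (a (\<phi> i)) (e i)) \<ge> 1"
      using big[unfolded split] small
        norm_triangle_ineq[of "\<Sum>i\<in>I-D. s (a (\<phi> i)) (e i)" "\<Sum>i\<in>D. s (a (\<phi> i)) (e i)"] by linarith
    moreover have "strict_mono_on (I - D) \<phi>" using I(2) by (auto simp: monotone_on_def)
    moreover obtain R' where R': "\<forall>j\<in>insert R (I \<union> \<phi> ` I). j < R'"
      using I(1) finite_nat_set_iff_bounded[of "insert R (I \<union> \<phi> ` I)"] by blast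
    moreover have "\<forall>i\<in>I-D. R \<le> i \<and> i < R' \<and> R \<le> \<phi> i \<and> \<phi> i < R'"
      using R' by (simp add: D_def not_less)
    ultimately show ?thesis
      using I(1) by (intro exI[of _ "I - D"] exI[of _ \<phi>] exI[of _ R']) simp
  qed
  then have "\<forall>R. \<exists>I \<phi> R'. R < R' \<and> finite I \<and> strict_mono_on I \<phi> \<and>
      (\<forall>i\<in>I. R \<le> i \<and> i < R' \<and> R \<le> \<phi> i \<and> \<phi> i < R') \<and> norm (\<Sum>i\<in>I. s (a (\<phi> i)) (e i)) \<ge> 1"
    by (rule allI)
  then obtain PI P\<phi> nxt where "\<forall>R. R < nxt R \<and> finite (PI R) \<and> strict_mono_on (PI R) (P\<phi> R) \<and>
      (\<forall>i\<in>PI R. R \<le> i \<and> i < nxt R \<and> R \<le> P\<phi> R i \<and> P\<phi> R i < nxt R) \<and>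
      norm (\<Sum>i\<in>PI R. s (a (P\<phi> R i)) (e i)) \<ge> 1"
    unfolding choice_iff by (elim exE)
  then have P: "\<And>R. R < nxt R" "\<And>R. finite (PI R)" "\<And>R. strict_mono_on (PI R) (P\<phi> R)"
    "\<And>R i. i \<in> PI R \<Longrightarrow> R \<le> i \<and> i < nxt R \<and> R \<le> P\<phi> R i \<and> P\<phi> R i < nxt R"
    "\<And>R. norm (\<Sum>i\<in>PI R. s (a (P\<phi> R i)) (e i)) \<ge> 1"
    by simp_all
  define Rs where "Rs k = (nxt ^^ k) 0" for k
  have Rs_Suc: "Rs (Suc k) = nxt (Rs k)" for k by (simp add: Rs_def)
  have Rs_mono: "strict_mono Rs" by (simp add: strict_mono_Suc_iff Rs_Suc P(1))
  define J where "J k = PI (Rs k)" for k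
  have J_range: "Rs k \<le> i \<and> i < Rs (Suc k)" and J_range': "Rs k \<le> P\<phi> (Rs k) i \<and> P\<phi> (Rs k) i < Rs (Suc k)" if "i \<in> J k" for i k
    using P(4) that by (auto simp: J_def Rs_Suc)
  have later: "Rs (Suc k) \<le> Rs l" if "k < l" for k l
    using Rs_mono that by (simp add: strict_mono_less_eq Suc_le_eq)
  have J_interval: "k = l" if "i \<in> J k" "Rs l \<le> i" "i < Rs (Suc l)" for i k l
    using J_range[OF that(1)] later[of k l] later[of l k] that(2,3)
    by (cases k l rule: linorder_cases) auto
  have J_disj: "k = l" if "i \<in> J k" "i \<in> J l" for i k l
    using J_interval[OF that(1)] J_range[OF that(2)] by blast
  define \<phi> where "\<phi> i = P\<phi> (Rs (THE k. i \<in> J k)) i" for i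
  have \<phi>: "\<phi> i = P\<phi> (Rs k) i" if "i \<in> J k" for i k
    using the_equality[of "\<lambda>k. i \<in> J k" k] that J_disj unfolding \<phi>_def by metis
  define JJ where "JJ = (\<Union>k. J k)"
  have \<phi>_mono: "\<phi> i < \<phi> j" if i: "i \<in> JJ" and j: "j \<in> JJ" and "i < j" for i j
  proof -
    obtain k l where kl: "i \<in> J k" "j \<in> J l" using i j by (auto simp: JJ_def)
    consider "k = l" | "k < l" | "l < k" by linarith
    then show ?thesis
    proof cases
      case 1
      then show ?thesis using kl \<phi> P(3)[of "Rs k"] \<open>i < j\<close> by (auto simp: J_def monotone_on_def)
    next
      case 2
      then show ?thesis
        using later[OF 2] \<phi> kl J_range'[OF kl(1)] J_range'[OF kl(2)] by simp
    next
      case 3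
      then show ?thesis
        using later[OF 3] J_range[OF kl(1)] J_range[OF kl(2)] \<open>i < j\<close> by simp
    qed
  qed
  have J_ne: "J k \<noteq> {}" for k
    using P(5)[of "Rs k"] by (auto simp: J_def)
  have "infinite JJ"
  proof
    assume "finite JJ"
    then obtain m where "\<forall>j\<in>JJ. j < m" using finite_nat_set_iff_bounded by blast
    moreover obtain i where i: "i \<in> J m" using J_ne by blast
    ultimately have "i < m" by (auto simp: JJ_def)
    then show False
      using J_range[OF i] strict_mono_imp_increasing[OF Rs_mono, of m] by simp
  qed
  define q where "q = enumerate JJ"
  have q: "strict_mono q" "range q = JJ"
    using strict_mono_enumerate[OF \<open>infinite JJ\<close>] range_enumerate[OF \<open>infinite JJ\<close>] by (auto simp: q_def)
  have q_in: "q n \<in> JJ" for n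
    using q(2) by blast
  define r where "r n = \<phi> (q n)" for n
  have r: "strict_mono r"
  proof (rule strict_monoI)
    fix m n :: nat assume "m < n"
    then show "r m < r n"
      unfolding r_def by (intro \<phi>_mono q_in strict_monoD[OF q(1)])
  qed
  have eqv: "summable (\<lambda>n. s (c n) (e n)) \<longleftrightarrow> summable (\<lambda>n. s (c n) (e (f n)))" if "strict_mono f" for f c
    using sub that by (simp add: subsymmetric_def equivalent_sequences_def)
  have "(\<lambda>n. s (a n) (e n)) summable_on UNIV"
    using sub conv by (simp add: subsymmetric_def unconditional_def)
  then have "(\<lambda>n. s (a n) (e n)) summable_on (range r)"
    by (rule summable_on_subset_banach) simp
  then have "(\<lambda>n. s (a (r n)) (e (r n))) summable_on UNIV"
    using r by (simp add: summable_on_reindex strict_mono_imp_inj_on o_def)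
  then have "summable (\<lambda>n. s (a (r n)) (e (r n)))"
    by (rule summable_on_imp_summable)
  then have "summable (\<lambda>n. s (a (r n)) (e (q n)))"
    using eqv[OF r, of "\<lambda>n. a (r n)"] eqv[OF q(1), of "\<lambda>n. a (r n)"] by simp
  then have fin: "summable (\<lambda>n. if n \<in> JJ then s (a (\<phi> n)) (e n) else 0)"
    using summable_mono_reindex[OF q(1), of "\<lambda>n. if n \<in> JJ then s (a (\<phi> n)) (e n) else 0"] q(2) q_in
    by (simp add: r_def)
  obtain N where N: "\<And>m n. m \<ge> N \<Longrightarrow> norm (\<Sum>i\<in>{m..<n}. if i \<in> JJ then s (a (\<phi> i)) (e i) else 0) < 1"
    using fin[unfolded summable_Cauchy, rule_format, of 1] by auto
  have "J N = {Rs N..<Rs (Suc N)} \<inter> JJ"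
  proof (intro set_eqI iffI)
    fix i assume "i \<in> J N"
    then show "i \<in> {Rs N..<Rs (Suc N)} \<inter> JJ" using J_range[of i N] by (auto simp: JJ_def)
  next
    fix i assume i: "i \<in> {Rs N..<Rs (Suc N)} \<inter> JJ"
    then obtain k where "i \<in> J k" by (auto simp: JJ_def)
    with i J_interval[of i k N] show "i \<in> J N" by simp
  qed
  then have "(\<Sum>i\<in>{Rs N..<Rs (Suc N)}. if i \<in> JJ then s (a (\<phi> i)) (e i) else 0) = (\<Sum>i\<in>J N. s (a (\<phi> i)) (e i))"
    by (simp only:) (rule sum.inter_restrict[symmetric], simp)
  also have "\<dots> = (\<Sum>i\<in>J N. s (a (P\<phi> (Rs N) i)) (e i))"
    by (intro sum.cong refl) (simp only: \<phi>)
  finally show False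
    using N[of "Rs N" "Rs (Suc N)"] P(5)[of "Rs N"] strict_mono_imp_increasing[OF Rs_mono, of N]
    by (simp add: J_def)
qed

end

section \<open>Finite coefficient lists and minors\<close>

text \<open>
  Finite coefficient sequences are lists, so that blocks are formed by concatenation; the position
  \<open>p\<close> allows the same list to be placed anywhere along the basis.
\<close>

primrec vec_at :: "('k \<Rightarrow> 'b \<Rightarrow> 'b::comm_monoid_add) \<Rightarrow> (nat \<Rightarrow> 'b) \<Rightarrow> nat \<Rightarrow> 'k list \<Rightarrow> 'b" where
  "vec_at s x p [] = 0"
| "vec_at s x p (c # cs) = s c (x p) + vec_at s x (Suc p) cs"

text \<open>
  \<open>xs\<close> is a minor of \<open>ys\<close> if it arises from \<open>ys\<close> by deleting entries, shrinking entries and inserting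
  zeros.  For a subsymmetric basis, none of these operations increases the norm by more than a constant
  factor, however many of them are combined.
\<close>

inductive minor :: "'k::real_normed_vector list \<Rightarrow> 'k list \<Rightarrow> bool" where
  minor_Nil: "minor [] ys"
| minor_zero: "minor xs ys \<Longrightarrow> minor (0 # xs) ys"
| minor_delete: "minor xs ys \<Longrightarrow> minor xs (y # ys)"
| minor_shrink: "norm x \<le> norm y \<Longrightarrow> minor xs ys \<Longrightarrow> minor (x # xs) (y # ys)"

lemma minor_append: "minor xs ys \<Longrightarrow> minor xs' ys' \<Longrightarrow> minor (xs @ xs') (ys @ ys')"
proof (induction rule: minor.induct)
  case (minor_Nil ys)
  then show ?case by (induction ys) (auto intro: minor.intros)
qed (auto intro: minor.intros)

lemma minor_replicate_zero: "minor (replicate n 0) ys"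
  by (induction n) (auto intro: minor.intros)

lemma minor_map:
  assumes "\<And>i. i \<in> set is \<Longrightarrow> norm (f i) \<le> norm (g i)"
  shows "minor (map f is) (map g is)"
  using assms by (induction "is") (auto intro: minor.intros)

lemma minor_refl: "minor xs xs"
  using minor_map[of xs "\<lambda>x. x" "\<lambda>x. x"] by simp

lemma minor_append_left: "minor xs ys \<Longrightarrow> minor xs (zs @ ys)"
  using minor_append[OF minor_Nil, of xs ys zs] by simp

lemma minor_append_right: "minor xs ys \<Longrightarrow> minor xs (ys @ zs)"
  using minor_append[OF _ minor_Nil, of xs ys zs] by simp

lemma minor_map_of_real:
  "minor xs ys \<Longrightarrow> minor (map of_real xs :: 'k::real_normed_field list) (map of_real ys)"
  by (induction rule: minor.induct) (auto intro: minor.intros)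

text \<open>
  The operators that will be bounded uniformly are given by an increasing map between coordinates and
  a multiplier, and this is what a minor amounts to.  The offsets \<open>p\<close> and \<open>q\<close> only serve the induction.
\<close>

lemma minor_indices:
  fixes xs ys :: "'k::real_normed_field list"
  assumes "minor xs ys"
  shows "\<exists>I \<phi> \<beta>. finite I \<and> strict_mono_on I \<phi> \<and>
    (\<forall>i\<in>I. p \<le> i \<and> i < p + length xs \<and> q \<le> \<phi> i \<and> \<phi> i < q + length ys \<and>
       norm (\<beta> i) \<le> 1 \<and> xs ! (i - p) = \<beta> i * ys ! (\<phi> i - q)) \<and>
    (\<forall>i<length xs. p + i \<notin> I \<longrightarrow> xs ! i = 0)"
  using assms
proof (induction arbitrary: p q rule: minor.induct)
  case (minor_Nil ys)
  show ?case by (intro exI[of _ "{}"]) (simp add: monotone_on_def)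
next
  case (minor_zero xs ys)
  from minor_zero.IH[of "Suc p" q] obtain I \<phi> \<beta> where I: "finite I" "strict_mono_on I \<phi>"
    and *: "\<And>i. i \<in> I \<Longrightarrow> Suc p \<le> i \<and> i < Suc p + length xs \<and> q \<le> \<phi> i \<and> \<phi> i < q + length ys \<and>
       norm (\<beta> i) \<le> 1 \<and> xs ! (i - Suc p) = \<beta> i * ys ! (\<phi> i - q)"
    and z: "\<And>i. i < length xs \<Longrightarrow> Suc p + i \<notin> I \<Longrightarrow> xs ! i = 0"
    by blast
  have "p \<le> i \<and> i < p + length (0 # xs) \<and> (0 # xs) ! (i - p) = \<beta> i * ys ! (\<phi> i - q)" if "i \<in> I" for i
    using *[OF that] by (auto simp: nth_Cons split: nat.split) (metis Suc_diff_le diff_Suc_Suc nat.inject)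
  moreover have "(0 # xs) ! i = 0" if "i < length (0 # xs)" "p + i \<notin> I" for i
    using z[of "i - 1"] that by (cases i) auto
  ultimately show ?case using I * by blast
next
  case (minor_delete xs ys y)
  from minor_delete.IH[of p "Suc q"] obtain I \<phi> \<beta> where I: "finite I" "strict_mono_on I \<phi>"
    and *: "\<And>i. i \<in> I \<Longrightarrow> p \<le> i \<and> i < p + length xs \<and> Suc q \<le> \<phi> i \<and> \<phi> i < Suc q + length ys \<and>
       norm (\<beta> i) \<le> 1 \<and> xs ! (i - p) = \<beta> i * ys ! (\<phi> i - Suc q)"
    and z: "\<And>i. i < length xs \<Longrightarrow> p + i \<notin> I \<Longrightarrow> xs ! i = 0"
    by blast
  have "q \<le> \<phi> i \<and> \<phi> i < q + length (y # ys) \<and> (y # ys) ! (\<phi> i - q) = ys ! (\<phi> i - Suc q)" if "i \<in> I" for i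
    using *[OF that] by (auto simp: nth_Cons')
  with I * z show ?case by (intro exI[of _ I] exI[of _ \<phi>] exI[of _ \<beta>]) auto
next
  case (minor_shrink x y xs ys)
  from minor_shrink.IH[of "Suc p" "Suc q"] obtain I \<phi> \<beta> where I: "finite I" "strict_mono_on I \<phi>"
    and *: "\<And>i. i \<in> I \<Longrightarrow> Suc p \<le> i \<and> i < Suc p + length xs \<and> Suc q \<le> \<phi> i \<and> \<phi> i < Suc q + length ys \<and>
       norm (\<beta> i) \<le> 1 \<and> xs ! (i - Suc p) = \<beta> i * ys ! (\<phi> i - Suc q)"
    and z: "\<And>i. i < length xs \<Longrightarrow> Suc p + i \<notin> I \<Longrightarrow> xs ! i = 0"
    by blast
  define \<phi>' where "\<phi>' = \<phi>(p := q)"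
  define \<beta>' where "\<beta>' = \<beta>(p := x / y)"
  have p: "p \<notin> I" using * by force
  have "strict_mono_on (insert p I) \<phi>'"
  proof (rule strict_mono_onI)
    fix i j assume ij: "i \<in> insert p I" "j \<in> insert p I" "i < j"
    then have "j \<in> I" "j \<noteq> p" using * by force+
    with ij show "\<phi>' i < \<phi>' j"
      using *[of j] I(2) by (auto simp: \<phi>'_def monotone_on_def)
  qed
  moreover have "p \<le> i \<and> i < p + length (x # xs) \<and> q \<le> \<phi>' i \<and> \<phi>' i < q + length (y # ys) \<and>
     norm (\<beta>' i) \<le> 1 \<and> (x # xs) ! (i - p) = \<beta>' i * (y # ys) ! (\<phi>' i - q)" if "i \<in> insert p I" for i
  proof (cases "i = p")
    case True
    have "norm (x / y) \<le> 1" "x = x / y * y"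
      using minor_shrink.hyps(1) by (cases "y = 0"; simp add: norm_divide divide_le_eq)+
    then show ?thesis using True by (simp add: \<phi>'_def \<beta>'_def)
  next
    case False
    then have "i \<in> I" using that by simp
    with *[OF this] False show ?thesis by (auto simp: \<phi>'_def \<beta>'_def nth_Cons')
  qed
  moreover have "(x # xs) ! i = 0" if "i < length (x # xs)" "p + i \<notin> insert p I" for i
    using z[of "i - 1"] that by (cases i) auto
  ultimately show ?case using I(1) by (intro exI[of _ "insert p I"] exI[of _ \<phi>'] exI[of _ \<beta>']) auto
qed

context scaled_space
begin

lemma vec_at_append: "vec_at s x p (xs @ ys) = vec_at s x p xs + vec_at s x (p + length xs) ys"
  by (induction xs arbitrary: p) (simp_all add: add.assoc)

lemma vec_at_replicate_zero [simp]: "vec_at s x p (replicate n 0) = 0"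
  by (induction n arbitrary: p) simp_all

lemma vec_at_scale: "vec_at s x p (map ((*) c) xs) = s c (vec_at s x p xs)"
  by (induction xs arbitrary: p) (simp_all add: bil.add_right)

lemma vec_at_conv_sum: "vec_at s x p xs = (\<Sum>i<length xs. s (xs ! i) (x (p + i)))"
proof (induction xs arbitrary: p)
  case (Cons c xs)
  show ?case
    unfolding vec_at.simps Cons by (simp add: sum.lessThan_Suc_shift del: sum.lessThan_Suc)
qed simp

lemma vec_at_map_upt: "vec_at s x 0 (map f [0..<n]) = (\<Sum>i<n. s (f i) (x i))"
  by (simp add: vec_at_conv_sum)

end

text \<open>
  Unlike subsymmetry, which is about convergence of series, this quantitative form mentions finite sums
  only and is inherited by the biorthogonal functionals.  One non-zero basis vector is enough to bound
  the norms of all of them away from 0.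
\<close>

locale spreading = scaled_banach s
  for s :: "'k::{real_normed_field, euclidean_space} \<Rightarrow> 'b::banach \<Rightarrow> 'b" +
  fixes x :: "nat \<Rightarrow> 'b" and K :: real
  assumes nonzero: "x 0 \<noteq> 0"
    and minor_le: "minor bs cs \<Longrightarrow> norm (vec_at s x 0 bs) \<le> K * norm (vec_at s x 0 cs)"

locale subsymmetric_basis = scaled_banach s
  for s :: "'k::{real_normed_field, euclidean_space} \<Rightarrow> 'a::banach \<Rightarrow> 'a" +
  fixes e :: "nat \<Rightarrow> 'a" and e' :: "nat \<Rightarrow> 'a \<Rightarrow>\<^sub>L 'k"
  assumes basis: "schauder_basis s e"
    and subsymm: "subsymmetric s e"
    and dual: "\<And>i. e' i \<in> dual_space s"
    and biorthogonal: "\<And>i j. blinfun_apply (e' i) (e j) = (if i = j then 1 else 0)"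
begin

lemma functional_scale [simp]: "blinfun_apply (e' i) (s c v) = c * blinfun_apply (e' i) v"
  using dual by (simp add: dual_space_def)

lemma e_nonzero: "e n \<noteq> 0"
  using biorthogonal[of n n] by (metis blinfun.zero_right zero_neq_one)

lemma expansion: "(\<lambda>n. s (blinfun_apply (e' n) v) (e n)) sums v"
proof -
  obtain a where a: "(\<lambda>n. s (a n) (e n)) sums v"
    using basis unfolding schauder_basis_def by blast
  have "blinfun_apply (e' i) v = a i" for i
  proof -
    have "(\<lambda>n. blinfun_apply (e' i) (s (a n) (e n))) sums blinfun_apply (e' i) v"
      by (rule bounded_linear.sums[OF blinfun.bounded_linear_right a])
    moreover have "(\<lambda>n. blinfun_apply (e' i) (s (a n) (e n))) = (\<lambda>n. if n = i then a n else 0)"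
      by (auto simp: biorthogonal)
    ultimately show ?thesis using sums_single[of i a] sums_unique2 by force
  qed
  with a show ?thesis by simp
qed

text \<open>
  For a single vector, spreading its coordinates gives bounded sums by
  \<open>subsymmetric_spread_bounded\<close>, and multipliers increase them by a constant factor only; uniform
  boundedness makes the bound proportional to the norm.
\<close>

lemma spread_multiplier_bounded:
  obtains K where "K \<ge> 0"
    "\<And>I \<phi> \<beta> v. finite I \<Longrightarrow> strict_mono_on I \<phi> \<Longrightarrow> (\<And>i. i \<in> I \<Longrightarrow> norm (\<beta> i) \<le> 1) \<Longrightarrow>
       norm (\<Sum>i\<in>I. s (\<beta> i * blinfun_apply (e' (\<phi> i)) v) (e i)) \<le> K * norm v"
proof -
  define T where "T = (\<lambda>(I, \<phi>, \<beta>) v. \<Sum>i\<in>I. s (\<beta> i * blinfun_apply (e' (\<phi> i)) v) (e i))"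
  define A where "A = {(I, \<phi>::nat \<Rightarrow> nat, \<beta>::nat \<Rightarrow> 'k). finite I \<and> strict_mono_on I \<phi> \<and> (\<forall>i\<in>I. norm (\<beta> i) \<le> 1)}"
  have "\<exists>K. \<forall>t\<in>A. \<forall>v. norm (T t v) \<le> K * norm v"
  proof (rule uniform_boundedness)
    fix t assume "t \<in> A"
    show "bounded_linear (T t)"
      unfolding T_def case_prod_beta
      by (intro bounded_linear_sum bounded_linear_compose[OF bil.bounded_linear_left]
          bounded_linear_const_mult blinfun.bounded_linear_right)
  next
    fix v
    obtain B where B: "\<And>I \<phi>. finite I \<Longrightarrow> strict_mono_on I \<phi> \<Longrightarrow>
        norm (\<Sum>i\<in>I. s (blinfun_apply (e' (\<phi> i)) v) (e i)) \<le> B"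
      using subsymmetric_spread_bounded[OF subsymm e_nonzero sums_summable[OF expansion[of v]]] by blast
    have "norm (T t v) \<le> 3 * real DIM('k) * B" if "t \<in> A" for t
    proof -
      obtain I \<phi> \<beta> where t: "t = (I, \<phi>, \<beta>)" by (cases t)
      with that have I: "finite I" "strict_mono_on I \<phi>" "\<And>i. i \<in> I \<Longrightarrow> norm (\<beta> i) \<le> 1"
        by (auto simp: A_def)
      have "norm (\<Sum>i\<in>I. s (\<beta> i) (s (blinfun_apply (e' (\<phi> i)) v) (e i))) \<le> 3 * real DIM('k) * B"
      proof (rule norm_multiplier_le[OF I(1) I(3)])
        fix G assume "G \<subseteq> I"
        with I show "norm (\<Sum>i\<in>G. s (blinfun_apply (e' (\<phi> i)) v) (e i)) \<le> B"
          by (intro B) (auto intro: finite_subset monotone_on_subset)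
      qed
      then show ?thesis by (simp add: t T_def)
    qed
    then show "\<exists>B. \<forall>t\<in>A. norm (T t v) \<le> B" by blast
  qed
  then obtain K where K: "\<And>t v. t \<in> A \<Longrightarrow> norm (T t v) \<le> K * norm v" by blast
  have "norm (\<Sum>i\<in>I. s (\<beta> i * blinfun_apply (e' (\<phi> i)) v) (e i)) \<le> \<bar>K\<bar> * norm v"
    if "finite I" "strict_mono_on I \<phi>" "\<And>i. i \<in> I \<Longrightarrow> norm (\<beta> i) \<le> 1" for I \<phi> \<beta> v
  proof -
    have "norm (T (I, \<phi>, \<beta>) v) \<le> K * norm v"
      by (rule K) (use that in \<open>simp add: A_def\<close>)
    also have "\<dots> \<le> \<bar>K\<bar> * norm v" by (intro mult_right_mono) auto
    finally show ?thesis by (simp add: T_def)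
  qed
  then show ?thesis using that[of "\<bar>K\<bar>"] by simp
qed

lemma functional_vec_at: "n < length xs \<Longrightarrow> blinfun_apply (e' n) (vec_at s e 0 xs) = xs ! n"
  by (simp add: vec_at_conv_sum blinfun.sum_right biorthogonal if_distrib cong: if_cong)

interpretation dual: scaled_banach "dual_scale :: 'k \<Rightarrow> ('a \<Rightarrow>\<^sub>L 'k) \<Rightarrow> _"
  by unfold_locales (rule normed_scaling_dual_scale)

lemma dual_vec_at_apply:
  "blinfun_apply (vec_at dual_scale e' 0 xs) v = (\<Sum>i<length xs. xs ! i * blinfun_apply (e' i) v)"
  by (simp add: dual.vec_at_conv_sum blinfun.sum_left)

lemma dual_vec_at_e: "n < length xs \<Longrightarrow> blinfun_apply (vec_at dual_scale e' 0 xs) (e n) = xs ! n"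
  by (simp add: dual_vec_at_apply biorthogonal if_distrib cong: if_cong)

lemma dual_vec_at_scale:
  "blinfun_apply (vec_at dual_scale e' 0 xs) (s c v) = c * blinfun_apply (vec_at dual_scale e' 0 xs) v"
  by (simp add: dual_vec_at_apply sum_distrib_left mult_ac)

text \<open>
  The operators that bound the functionals are adjoint to the operators that bound the basis, with
  the roles of the two index sequences exchanged.
\<close>

theorem spreading_with_dual: "\<exists>K. spreading s e K \<and> spreading dual_scale e' K"
proof -
  obtain K where "K \<ge> 0" and K: "\<And>I \<phi> \<beta> v. finite I \<Longrightarrow> strict_mono_on I \<phi> \<Longrightarrow>
      (\<And>i. i \<in> I \<Longrightarrow> norm (\<beta> i) \<le> 1) \<Longrightarrow>
      norm (\<Sum>i\<in>I. s (\<beta> i * blinfun_apply (e' (\<phi> i)) v) (e i)) \<le> K * norm v"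
    using spread_multiplier_bounded by blast
  have "norm (vec_at s e 0 bs) \<le> K * norm (vec_at s e 0 cs) \<and>
      norm (vec_at dual_scale e' 0 bs) \<le> K * norm (vec_at dual_scale e' 0 cs)"
    if minor: "minor bs cs" for bs cs :: "'k list"
  proof
    obtain I \<phi> \<beta> where I: "finite I" "strict_mono_on I \<phi>"
      and *: "\<And>i. i \<in> I \<Longrightarrow> i < length bs \<and> \<phi> i < length cs \<and> norm (\<beta> i) \<le> 1 \<and> bs ! i = \<beta> i * cs ! (\<phi> i)"
      and z: "\<And>i. i < length bs \<Longrightarrow> i \<notin> I \<Longrightarrow> bs ! i = 0"
      using minor_indices[OF minor, of 0 0, simplified] by blast
    have sub: "I \<subseteq> {..<length bs}" using * by auto
    have "vec_at s e 0 bs = (\<Sum>i\<in>I. s (bs ! i) (e i))"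
      unfolding vec_at_conv_sum by (rule sum.mono_neutral_cong_right) (use sub z in auto)
    also have "\<dots> = (\<Sum>i\<in>I. s (\<beta> i * blinfun_apply (e' (\<phi> i)) (vec_at s e 0 cs)) (e i))"
      using * by (intro sum.cong) (simp_all add: functional_vec_at)
    also have "norm \<dots> \<le> K * norm (vec_at s e 0 cs)"
      using I * by (intro K) auto
    finally show "norm (vec_at s e 0 bs) \<le> K * norm (vec_at s e 0 cs)" .
    show "norm (vec_at dual_scale e' 0 bs) \<le> K * norm (vec_at dual_scale e' 0 cs)"
    proof (rule norm_blinfun_bound)
      fix w
      define \<psi> where "\<psi> = the_inv_into I \<phi>"
      have inj: "inj_on \<phi> I" by (rule strict_mono_on_imp_inj_on[OF I(2)])
      have \<psi>: "\<psi> (\<phi> i) = i" if "i \<in> I" for i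
        unfolding \<psi>_def by (rule the_inv_into_f_f[OF inj that])
      have \<psi>_mono: "strict_mono_on (\<phi> ` I) \<psi>"
        using I(2) by (auto intro!: strict_mono_onI simp: \<psi> strict_mono_on_less)
      have "blinfun_apply (vec_at dual_scale e' 0 bs) w = (\<Sum>i\<in>I. bs ! i * blinfun_apply (e' i) w)"
        unfolding dual_vec_at_apply by (rule sum.mono_neutral_cong_right) (use sub z in auto)
      also have "\<dots> = blinfun_apply (vec_at dual_scale e' 0 cs) (\<Sum>i\<in>I. s (\<beta> i * blinfun_apply (e' i) w) (e (\<phi> i)))"
        using * by (simp add: blinfun.sum_right dual_vec_at_scale dual_vec_at_e mult_ac)
      also have "(\<Sum>i\<in>I. s (\<beta> i * blinfun_apply (e' i) w) (e (\<phi> i))) =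
          (\<Sum>j\<in>\<phi> ` I. s (\<beta> (\<psi> j) * blinfun_apply (e' (\<psi> j)) w) (e j))"
        by (simp add: sum.reindex[OF inj] \<psi>)
      finally have "norm (blinfun_apply (vec_at dual_scale e' 0 bs) w) \<le> norm (vec_at dual_scale e' 0 cs) *
          norm (\<Sum>j\<in>\<phi> ` I. s (\<beta> (\<psi> j) * blinfun_apply (e' (\<psi> j)) w) (e j))"
        by (simp add: norm_blinfun)
      also have "\<dots> \<le> norm (vec_at dual_scale e' 0 cs) * (K * norm w)"
        using I(1) * \<psi> \<psi>_mono by (intro mult_left_mono K) auto
      finally show "norm (blinfun_apply (vec_at dual_scale e' 0 bs) w) \<le> K * norm (vec_at dual_scale e' 0 cs) * norm w"
        by (simp add: mult_ac)
    qed (use \<open>K \<ge> 0\<close> in simp)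
  qed
  moreover have "e' 0 \<noteq> 0"
    using biorthogonal[of 0 0] by auto
  ultimately have "spreading s e K" "spreading dual_scale e' K"
    by unfold_locales (auto simp: e_nonzero)
  then show ?thesis by blast
qed

end

section \<open>Block sequences of growing copies\<close>

context scaled_banach
begin

lemma summable_if_sums_dominated:
  assumes "summable (g :: nat \<Rightarrow> 'b)" "\<And>m n. norm (sum f {m..<n}) \<le> C * norm (sum g {m..<n})"
  shows "summable (f :: nat \<Rightarrow> 'b)"
  unfolding summable_Cauchy
proof (intro allI impI)
  fix \<epsilon> :: real assume \<epsilon>: "\<epsilon> > 0"
  then have "\<epsilon> / (\<bar>C\<bar> + 1) > 0" by simp
  then obtain N where N: "\<And>m n. m \<ge> N \<Longrightarrow> norm (sum g {m..<n}) < \<epsilon> / (\<bar>C\<bar> + 1)"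
    using assms(1) unfolding summable_Cauchy by blast
  have "norm (sum f {m..<n}) < \<epsilon>" if "m \<ge> N" for m n
  proof -
    have "norm (sum f {m..<n}) \<le> (\<bar>C\<bar> + 1) * norm (sum g {m..<n})"
      using assms(2)[of m n] by (smt (verit) mult_right_mono norm_ge_zero)
    also have "\<dots> < \<epsilon>"
      using N[OF that, of n] by (simp add: pos_less_divide_eq mult.commute)
    finally show ?thesis .
  qed
  then show "\<exists>N. \<forall>m\<ge>N. \<forall>n. norm (sum f {m..<n}) < \<epsilon>" by blast
qed

lemma span_range_finite_sum:
  fixes y :: "nat \<Rightarrow> 'b"
  assumes "w \<in> module.span s (range y)"
  shows "\<exists>a n. \<forall>m\<ge>n. w = (\<Sum>i<m. s (a i) (y i))"
  using assms
proof (induction rule: vs.span_induct_alt)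
  case base
  show ?case by (intro exI[of _ "\<lambda>_. 0"]) simp
next
  case (step c v w)
  then obtain j :: nat and a n where j: "v = y j" and an: "\<And>m. m \<ge> n \<Longrightarrow> w = (\<Sum>i<m. s (a i) (y i))" by blast
  have "s c v + w = (\<Sum>i<m. s (a i + (if i = j then c else 0)) (y i))" if "m \<ge> max n (Suc j)" for m
  proof -
    have "(\<Sum>i<m. s (if i = j then c else 0) (y i)) = (\<Sum>i<m. if i = j then s c (y i) else 0)"
      by (intro sum.cong) auto
    also have "\<dots> = s c v" using that j by simp
    finally show ?thesis using an[of m] that by (simp add: bil.add_left sum.distrib)
  qed
  then show ?case
    by (intro exI[of _ "\<lambda>i. a i + (if i = j then c else 0)"] exI[of _ "max n (Suc j)"]) blast
qed

text \<open>
  The monotonicity bounds each coefficient of a finite sum by the norm of the sum.  So if finite sums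
  converge to \<open>v\<close>, then their coefficients converge, and the limits are the coefficients of an expansion
  of \<open>v\<close>, because the errors of the partial sums are controlled uniformly in their length.
\<close>

lemma unconditional_if_monotone:
  assumes nz: "\<And>n. y n \<noteq> 0"
    and mono: "\<And>n b c. (\<And>i. i < n \<Longrightarrow> norm (b i) \<le> norm (c i)) \<Longrightarrow>
      norm (\<Sum>i<n. s (b i) (y i)) \<le> K * norm (\<Sum>i<n. s (c i) (y i))"
  shows "unconditional s y"
proof -
  have K: "K \<ge> 0"
  proof (rule ccontr)
    assume "\<not> K \<ge> 0"
    moreover have "norm (y 0) > 0" using nz by simp
    ultimately have "K * norm (y 0) < 0" by (simp add: mult_neg_pos)
    then show False using mono[of 1 "\<lambda>_. 1" "\<lambda>_. 1"] \<open>norm (y 0) > 0\<close> by simp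
  qed
  have set_mono: "norm (\<Sum>i\<in>F. s (c i) (y i)) \<le> K * norm (\<Sum>i<n. s (c i) (y i))" if "F \<subseteq> {..<n}" for F c n
  proof -
    have "(\<Sum>i\<in>F. s (c i) (y i)) = (\<Sum>i<n. s (if i \<in> F then c i else 0) (y i))"
      by (rule sum.mono_neutral_cong_left) (use that in auto)
    then show ?thesis using mono[of n "\<lambda>i. if i \<in> F then c i else 0" c] by simp
  qed
  have coeff: "norm (c j) * norm (y j) \<le> K * norm (\<Sum>i<n. s (c i) (y i))" if "j < n" for c j n
    using set_mono[of "{j}" n c] that by (simp add: norm_scale)
  have "basic_sequence s y"
    unfolding basic_sequence_def
  proof (intro ballI ex_ex1I)
    fix v a c
    assume "(\<lambda>n. s (a n) (y n)) sums v" "(\<lambda>n. s (c n) (y n)) sums v"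
    then have "(\<lambda>n. s (a n - c n) (y n)) sums 0"
      using sums_diff by (fastforce simp: bil.diff_left)
    then have "(\<lambda>n. K * norm (\<Sum>i<n. s (a i - c i) (y i))) \<longlonglongrightarrow> K * norm (0::'b)"
      unfolding sums_def by (intro tendsto_intros)
    moreover have "\<forall>\<^sub>F n in sequentially. norm (a j - c j) * norm (y j) \<le> K * norm (\<Sum>i<n. s (a i - c i) (y i))" for j
      using eventually_gt_at_top[of j] by eventually_elim (rule coeff)
    ultimately have "norm (a j - c j) * norm (y j) \<le> K * norm (0::'b)" for j
      by (intro tendsto_lowerbound[where F = sequentially]) auto
    then show "a = c" using nz by (auto simp: mult_le_0_iff)
  next
    fix v assume "v \<in> closed_span s y"
    then obtain w where w: "\<And>k. w k \<in> module.span s (range y)" "w \<longlonglongrightarrow> v"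
      unfolding closed_span_def closure_sequential by blast
    have "\<forall>k. \<exists>a n. \<forall>m\<ge>n. w k = (\<Sum>i<m. s (a i) (y i))"
      using span_range_finite_sum w(1) by blast
    then obtain a n where an: "\<And>k m. m \<ge> n k \<Longrightarrow> w k = (\<Sum>i<m. s (a k i) (y i))"
      unfolding choice_iff by blast
    have diff: "w k - w l = (\<Sum>i<m. s (a k i - a l i) (y i))" if "m \<ge> max (n k) (n l)" for k l m
      using an[of k m] an[of l m] that by (simp add: bil.diff_left sum_subtractf)
    have part: "norm (\<Sum>i<m. s (a k i - a l i) (y i)) \<le> K * norm (w k - w l)" for m k l
      using set_mono[of "{..<m}" "max m (max (n k) (n l))" "\<lambda>i. a k i - a l i"]
        diff[of k l "max m (max (n k) (n l))"] by simp
    have Cw: "Cauchy w" using w(2) by (rule LIMSEQ_imp_Cauchy)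
    have "Cauchy (\<lambda>k. a k i)" for i
    proof (rule metric_CauchyI)
      fix \<epsilon> :: real assume "\<epsilon> > 0"
      then have "\<epsilon> * norm (y i) / (K + 1) > 0" using K nz by simp
      then obtain M where M: "\<And>k l. k \<ge> M \<Longrightarrow> l \<ge> M \<Longrightarrow> norm (w k - w l) < \<epsilon> * norm (y i) / (K + 1)"
        using Cw unfolding Cauchy_iff by blast
      have "dist (a k i) (a l i) < \<epsilon>" if "k \<ge> M" "l \<ge> M" for k l
      proof -
        define m where "m = max (Suc i) (max (n k) (n l))"
        have "norm (a k i - a l i) * norm (y i) \<le> K * norm (w k - w l)"
          using coeff[of i m "\<lambda>i. a k i - a l i"] diff[of k l m] by (simp add: m_def)
        also have "\<dots> \<le> (K + 1) * norm (w k - w l)" by (simp add: mult_right_mono)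
        also have "\<dots> < \<epsilon> * norm (y i)" using M[OF that] K by (simp add: pos_less_divide_eq mult.commute)
        finally show ?thesis using nz[of i] by (simp add: dist_norm)
      qed
      then show "\<exists>M. \<forall>m\<ge>M. \<forall>n\<ge>M. dist (a m i) (a n i) < \<epsilon>" by blast
    qed
    then have "\<forall>i. \<exists>c. (\<lambda>k. a k i) \<longlonglongrightarrow> c"
      by (simp add: Cauchy_convergent_iff convergent_def)
    then obtain c where c: "\<And>i. (\<lambda>k. a k i) \<longlonglongrightarrow> c i"
      unfolding choice_iff by blast
    have "(\<lambda>i. s (c i) (y i)) sums v"
      unfolding sums_def
    proof (rule metric_LIMSEQ_I)
      fix \<epsilon> :: real assume "\<epsilon> > 0"
      then have \<epsilon>: "\<epsilon> / (K + 2) > 0" using K by simp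
      obtain M where M: "\<And>k l. k \<ge> M \<Longrightarrow> l \<ge> M \<Longrightarrow> norm (w k - w l) < \<epsilon> / (K + 2)"
        using Cw \<epsilon> unfolding Cauchy_iff by blast
      have "norm (w M - v) \<le> \<epsilon> / (K + 2)"
      proof (rule tendsto_upperbound)
        show "(\<lambda>l. norm (w M - w l)) \<longlonglongrightarrow> norm (w M - v)"
          by (intro tendsto_intros w(2))
        show "\<forall>\<^sub>F l in sequentially. norm (w M - w l) \<le> \<epsilon> / (K + 2)"
          using eventually_ge_at_top[of M] by eventually_elim (use M in \<open>simp add: less_imp_le\<close>)
      qed simp
      have "dist (\<Sum>i<m. s (c i) (y i)) v < \<epsilon>" if "m \<ge> n M" for m
      proof -
        have "norm (\<Sum>i<m. s (a M i - c i) (y i)) \<le> K * (\<epsilon> / (K + 2))"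
        proof (rule tendsto_upperbound)
          show "(\<lambda>l. norm (\<Sum>i<m. s (a M i - a l i) (y i))) \<longlonglongrightarrow> norm (\<Sum>i<m. s (a M i - c i) (y i))"
            by (intro tendsto_norm tendsto_sum bil.tendsto tendsto_intros c)
          show "\<forall>\<^sub>F l in sequentially. norm (\<Sum>i<m. s (a M i - a l i) (y i)) \<le> K * (\<epsilon> / (K + 2))"
            using eventually_ge_at_top[of M]
          proof eventually_elim
            case (elim l)
            show ?case using M[of M l] elim K
              by (intro order_trans[OF part] mult_left_mono) (simp_all add: less_imp_le)
          qed
        qed simp
        then have "norm (w M - (\<Sum>i<m. s (c i) (y i))) \<le> K * (\<epsilon> / (K + 2))"
          using an[OF that] by (simp add: bil.diff_left sum_subtractf)
        with \<open>norm (w M - v) \<le> \<epsilon> / (K + 2)\<close>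
        have "norm ((\<Sum>i<m. s (c i) (y i)) - v) \<le> K * (\<epsilon> / (K + 2)) + \<epsilon> / (K + 2)"
          using norm_triangle_ineq4[of "w M - v" "w M - (\<Sum>i<m. s (c i) (y i))"] by simp
        also have "\<dots> = (K + 1) * (\<epsilon> / (K + 2))" by (simp only: distrib_right mult_1_left)
        also have "\<dots> < (K + 2) * (\<epsilon> / (K + 2))" using \<epsilon> by (intro mult_strict_right_mono) auto
        also have "\<dots> = \<epsilon>" using K by simp
        finally show ?thesis by (simp add: dist_norm)
      qed
      then show "\<exists>no. \<forall>m\<ge>no. dist (\<Sum>i<m. s (c i) (y i)) v < \<epsilon>" by blast
    qed
    then show "\<exists>a. (\<lambda>n. s (a n) (y n)) sums v" by blast
  qed
  moreover have "(\<lambda>n. s (a n) (y n)) summable_on UNIV" if sm: "summable (\<lambda>n. s (a n) (y n))" for a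
  proof -
    define f where "f n = s (a n) (y n)" for n
    have tail: "norm (sum f F - sum f {..<N}) \<le> K * norm (sum f {N..<n})"
      if F: "{..<N} \<subseteq> F" "F \<subseteq> {..<n}" for F N n
    proof -
      have "finite F" using F(2) finite_subset by blast
      then have "sum f F - sum f {..<N} = sum f (F - {..<N})"
        using F(1) by (rule sum_diff[symmetric])
      also have "\<dots> = (\<Sum>i\<in>F - {..<N}. s (if i < N then 0 else a i) (y i))"
        by (intro sum.cong) (auto simp: f_def)
      also have "norm \<dots> \<le> K * norm (\<Sum>i<n. s (if i < N then 0 else a i) (y i))"
        by (rule set_mono) (use F in auto)
      also have "(\<Sum>i<n. s (if i < N then 0 else a i) (y i)) = sum f {N..<n}"
        unfolding f_def by (rule sum.mono_neutral_cong_right) auto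
      finally show ?thesis .
    qed
    have "(f has_sum suminf f) UNIV"
      unfolding has_sum_def
    proof (rule tendstoI)
      fix \<epsilon> :: real assume "\<epsilon> > 0"
      then have \<epsilon>: "\<epsilon> / (K + 2) > 0" using K by simp
      obtain N1 where N1: "\<And>m n. m \<ge> N1 \<Longrightarrow> norm (sum f {m..<n}) < \<epsilon> / (K + 2)"
        using sm \<epsilon> unfolding f_def[symmetric] summable_Cauchy by blast
      have le: "norm (sum f {..<N1} - sum f {..<n}) \<le> \<epsilon> / (K + 2)" if "n \<ge> N1" for n
      proof -
        have "sum f {..<n} - sum f {..<N1} = sum f {N1..<n}"
          using sum_diff_nat_ivl[of 0 N1 n f] that by (simp add: lessThan_atLeast0)
        then show ?thesis
          using N1[of N1 n] by (subst norm_minus_commute) simp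
      qed
      have limit_le: "norm (sum f {..<N1} - suminf f) \<le> \<epsilon> / (K + 2)"
      proof (rule tendsto_upperbound)
        show "(\<lambda>n. norm (sum f {..<N1} - sum f {..<n})) \<longlonglongrightarrow> norm (sum f {..<N1} - suminf f)"
          using sm by (intro tendsto_intros summable_LIMSEQ) (simp add: f_def)
        show "\<forall>\<^sub>F n in sequentially. norm (sum f {..<N1} - sum f {..<n}) \<le> \<epsilon> / (K + 2)"
          using eventually_ge_at_top[of N1] by eventually_elim (rule le)
      qed simp
      have "dist (sum f F) (suminf f) < \<epsilon>" if F: "finite F" "{..<N1} \<subseteq> F" for F
      proof -
        obtain n where n: "F \<subseteq> {..<n}" using finite_nat_iff_bounded F(1) by blast
        have "norm (sum f F - sum f {..<N1}) \<le> K * (\<epsilon> / (K + 2))"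
          using N1[of N1 n] K by (intro order_trans[OF tail[OF F(2) n]] mult_left_mono) auto
        with limit_le
        have "norm (sum f F - suminf f) \<le> K * (\<epsilon> / (K + 2)) + \<epsilon> / (K + 2)"
          using norm_triangle_ineq[of "sum f F - sum f {..<N1}" "sum f {..<N1} - suminf f"] by simp
        also have "\<dots> = (K + 1) * (\<epsilon> / (K + 2))" by (simp only: distrib_right mult_1_left)
        also have "\<dots> < (K + 2) * (\<epsilon> / (K + 2))" using \<epsilon> by (intro mult_strict_right_mono) auto
        also have "\<dots> = \<epsilon>" using K by simp
        finally show ?thesis by (simp add: dist_norm)
      qed
      then show "\<forall>\<^sub>F F in finite_subsets_at_top UNIV. dist (sum f F) (suminf f) < \<epsilon>"
        unfolding eventually_finite_subsets_at_top by (intro exI[of _ "{..<N1}"]) auto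
    qed
    then show ?thesis by (auto simp: f_def[abs_def] summable_on_def)
  qed
  ultimately show ?thesis unfolding unconditional_def by blast
qed

end

text \<open>
  Lists \<open>L i\<close> placed at positions \<open>P i\<close>, with zeros in the gaps, become a single list.  Two such layouts
  with different gaps can then be compared termwise.
\<close>

primrec layout :: "(nat \<Rightarrow> nat) \<Rightarrow> (nat \<Rightarrow> 'k list) \<Rightarrow> nat \<Rightarrow> 'k::zero list" where
  "layout P L 0 = []"
| "layout P L (Suc n) = layout P L n @ replicate (P n - length (layout P L n)) 0 @ L n"

lemma length_layout:
  assumes "\<And>i. P i + length (L i) \<le> P (Suc i)"
  shows "length (layout P L n) \<le> P n"
proof (induction n)
  case (Suc n)
  then show ?case using assms[of n] by simp
qed simp

lemma minor_layout:
  assumes "\<And>i. i < n \<Longrightarrow> minor (L i) (L' i)"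
  shows "minor (layout P L n) (layout P' L' n)"
  using assms
proof (induction n)
  case (Suc n)
  then show ?case
    by (auto intro!: minor_append minor_append_left[of _ "L' n"] minor_append[OF minor_replicate_zero, of "L n" _ _ "[]", simplified])
qed (auto intro: minor.intros)

context spreading
begin

lemma vec_at_layout:
  assumes "\<And>i. P i + length (L i) \<le> P (Suc i)"
  shows "vec_at s x 0 (layout P L n) = (\<Sum>i<n. vec_at s x (P i) (L i))"
proof (induction n)
  case (Suc n)
  then show ?case using length_layout[of P L n] assms by (simp add: vec_at_append)
qed simp

lemma sum_vec_at_le:
  assumes P: "\<And>i. P i + length (L i) \<le> P (Suc i)" and P': "\<And>i. P' i + length (L' i) \<le> P' (Suc i)"
    and minor: "\<And>i. m \<le> i \<Longrightarrow> i < n \<Longrightarrow> minor (L i) (L' i)"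
  shows "norm (\<Sum>i=m..<n. vec_at s x (P i) (L i)) \<le> K * norm (\<Sum>i=m..<n. vec_at s x (P' i) (L' i))"
proof -
  \<comment> \<open>Emptying the lists below \<open>m\<close> makes the sums start at 0.\<close>
  define M where "M i = (if i < m then [] else L i)" for i
  define M' where "M' i = (if i < m then [] else L' i)" for i
  have "P i + length (M i) \<le> P (Suc i)" "P' i + length (M' i) \<le> P' (Suc i)" for i
    using P[of i] P'[of i] by (auto simp: M_def M'_def)
  then have eq: "vec_at s x 0 (layout P M n) = (\<Sum>i<n. vec_at s x (P i) (M i))"
      "vec_at s x 0 (layout P' M' n) = (\<Sum>i<n. vec_at s x (P' i) (M' i))"
    by (intro vec_at_layout; simp)+
  have "norm (vec_at s x 0 (layout P M n)) \<le> K * norm (vec_at s x 0 (layout P' M' n))"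
    by (intro minor_le minor_layout) (simp add: minor M_def M'_def minor_Nil)
  moreover have "(\<Sum>i<n. vec_at s x (P i) (M i)) = (\<Sum>i=m..<n. vec_at s x (P i) (L i))"
    by (rule sum.mono_neutral_cong_right) (auto simp: M_def)
  moreover have "(\<Sum>i<n. vec_at s x (P' i) (M' i)) = (\<Sum>i=m..<n. vec_at s x (P' i) (L' i))"
    by (rule sum.mono_neutral_cong_right) (auto simp: M'_def)
  ultimately show ?thesis by (simp add: eq)
qed

lemma vec_at_le:
  assumes "minor bs cs"
  shows "norm (vec_at s x p bs) \<le> K * norm (vec_at s x q cs)"
proof -
  have "norm (vec_at s x 0 (replicate p 0 @ bs)) \<le> K * norm (vec_at s x 0 (replicate q 0 @ cs))"
    by (intro minor_le minor_append minor_replicate_zero assms)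
  then show ?thesis by (simp add: vec_at_append)
qed

lemma K_ge_1: "K \<ge> 1"
  using vec_at_le[OF minor_refl, of 0 "[1]" 0] nonzero by (simp add: norm_scale)

lemma entry_le:
  assumes "c \<in> set cs"
  shows "norm c * norm (x 0) \<le> K * norm (vec_at s x p cs)"
proof -
  obtain us vs where "cs = us @ c # vs" using assms split_list by metis
  then have "minor [c] cs" by (auto intro!: minor_append_left minor_shrink minor_Nil)
  from vec_at_le[OF this, of 0 p] show ?thesis by (simp add: norm_scale)
qed

end

text \<open>
  Blocks cannot repeat the infinite list \<open>A 0 @ A 1 @ \<dots>\<close>, so the \<open>j\<close>-th block carries its first \<open>j + 1\<close>
  pieces.  Since the pieces have geometrically decreasing norms, the truncation is immaterial, and the
  blocks behave like copies of one vector.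
\<close>

locale growing_copies = spreading s x K
  for s :: "'k::{real_normed_field, euclidean_space} \<Rightarrow> 'b::banach \<Rightarrow> 'b" and x K +
  fixes A :: "nat \<Rightarrow> 'k list"
  assumes A0: "\<exists>c\<in>set (A 0). c \<noteq> 0"
    and A_small: "\<And>k. norm (vec_at s x 0 (A k)) \<le> (1/2) ^ k"
begin

definition trunc :: "nat \<Rightarrow> 'k list" where
  "trunc j = concat (map A [0..<Suc j])"

definition start :: "nat \<Rightarrow> nat" where
  "start j = (\<Sum>i<j. length (trunc i))"

definition copy :: "nat \<Rightarrow> 'b" where
  "copy j = vec_at s x (start j) (trunc j)"

lemma start_Suc: "start (Suc j) = start j + length (trunc j)"
  by (simp add: start_def)

lemma strict_mono_start: "strict_mono start"
  using A0 by (auto simp: strict_mono_Suc_iff start_Suc trunc_def simp del: upt_Suc simp: upt_rec[of 0])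

lemma copy_bounded_below: "\<exists>\<delta>>0. \<forall>j. \<delta> \<le> norm (copy j)"
proof -
  obtain c where c: "c \<in> set (A 0)" "c \<noteq> 0" using A0 by blast
  have "norm c * norm (x 0) / K \<le> norm (copy j)" for j
  proof -
    have "c \<in> set (trunc j)" using c(1) by (force simp: trunc_def simp del: upt_Suc)
    from entry_le[OF this, of "start j"] show ?thesis
      using K_ge_1 by (simp add: copy_def field_simps)
  qed
  moreover have "norm c * norm (x 0) / K > 0" using c nonzero K_ge_1 by simp
  ultimately show ?thesis by blast
qed

lemma scale_copy: "s c (copy j) = vec_at s x (start j) (map ((*) c) (trunc j))"
  by (simp add: copy_def vec_at_scale)

lemma block_basis_copy: "block_basis s x copy"
proof -
  \<comment> \<open>\<open>blk k\<close> is the number of the block that contains the coordinate \<open>k\<close>.\<close>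
  define blk where "blk k = (LEAST n. k < start (Suc n))" for k
  define a where "a k = trunc (blk k) ! (k - start (blk k))" for k
  have blk: "blk k = n" if "start n \<le> k" "k < start (Suc n)" for k n
    unfolding blk_def
  proof (rule Least_equality)
    show "k < start (Suc n)" by fact
    fix m assume "k < start (Suc m)"
    with that(1) have "start n < start (Suc m)" by simp
    then show "n \<le> m" using strict_mono_start by (simp add: strict_mono_less)
  qed
  have "copy n = (\<Sum>k\<in>{start n..<start (Suc n)}. s (a k) (x k))" for n
  proof -
    have "copy n = (\<Sum>i = 0..<length (trunc n). s (trunc n ! i) (x (start n + i)))"
      by (simp add: copy_def vec_at_conv_sum lessThan_atLeast0)
    also have "\<dots> = (\<Sum>k\<in>{start n..<start (Suc n)}. s (trunc n ! (k - start n)) (x k))"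
      using sum.shift_bounds_nat_ivl[of "\<lambda>k. s (trunc n ! (k - start n)) (x k)" 0 "start n" "length (trunc n)"]
      by (simp add: start_Suc add.commute)
    also have "\<dots> = (\<Sum>k\<in>{start n..<start (Suc n)}. s (a k) (x k))"
      by (intro sum.cong) (auto simp: a_def blk)
    finally show ?thesis .
  qed
  moreover have "copy n \<noteq> 0" for n
    using copy_bounded_below by (metis norm_zero not_le)
  ultimately show ?thesis
    unfolding block_basis_def using strict_mono_start by blast
qed

lemma tail_small: "a \<le> b \<Longrightarrow> norm (vec_at s x p (concat (map A [a..<b]))) \<le> 2 * K * ((1/2) ^ a - (1/2) ^ b)"
proof (induction b rule: dec_induct)
  case (step b)
  have "norm (vec_at s x q (A b)) \<le> K * (1/2) ^ b" for q
  proof -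
    have "norm (vec_at s x q (A b)) \<le> K * norm (vec_at s x 0 (A b))"
      by (rule vec_at_le[OF minor_refl])
    also have "\<dots> \<le> K * (1/2) ^ b"
      using K_ge_1 A_small[of b] by (intro mult_left_mono) auto
    finally show ?thesis .
  qed
  then have "norm (vec_at s x p (concat (map A [a..<Suc b]))) \<le> 2 * K * ((1/2) ^ a - (1/2) ^ b) + K * (1/2) ^ b"
    using step by (simp add: vec_at_append) (meson add_mono norm_triangle_ineq order_trans)
  then show ?case by (simp add: algebra_simps)
qed simp

lemma coeffs_bounded:
  assumes "summable (\<lambda>i. s (c i) (copy (r i)))"
  obtains M where "\<And>i. norm (c i) \<le> M"
proof -
  obtain \<delta> where \<delta>: "\<delta> > 0" "\<And>j. \<delta> \<le> norm (copy j)" using copy_bounded_below by blast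
  have "(\<lambda>i. norm (s (c i) (copy (r i)))) \<longlonglongrightarrow> 0"
    by (intro tendsto_norm_zero summable_LIMSEQ_zero assms)
  then obtain M where M: "\<And>i. norm (s (c i) (copy (r i))) \<le> M"
    using convergent_imp_Bseq[OF convergentI] by (fastforce simp: Bseq_def)
  have "norm (c i) \<le> M / \<delta>" for i
  proof -
    have "norm (c i) * \<delta> \<le> M"
      using M[of i] \<delta>(2)[of "r i"] by (intro order_trans[OF mult_left_mono[OF \<delta>(2)[of "r i"]]]) (simp_all add: norm_scale)
    then show ?thesis using \<delta>(1) by (simp add: field_simps)
  qed
  then show ?thesis by (rule that)
qed

text \<open>
  Passing from \<open>copy i\<close> to \<open>copy (r i)\<close> only moves the coefficients and appends a tail of norm at most
  a multiple of \<open>(1/2) ^ i\<close>, and the tails of a series with bounded coefficients converge absolutely.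
\<close>

lemma summable_copy_subseq:
  assumes r: "strict_mono r"
  shows "summable (\<lambda>i. s (c i) (copy i)) \<longleftrightarrow> summable (\<lambda>i. s (c i) (copy (r i)))"
proof -
  define z where "z i = vec_at s x (start (r i)) (trunc i)" for i
  define t where "t i = vec_at s x (start (r i) + length (trunc i)) (concat (map A [Suc i..<Suc (r i)]))" for i
  have ri: "i \<le> r i" for i using r by (rule strict_mono_imp_increasing)
  have trunc_r: "trunc (r i) = trunc i @ concat (map A [Suc i..<Suc (r i)])" for i
    using upt_add_eq_append[of 0 "Suc i" "r i - i"] ri[of i]
    by (simp add: trunc_def del: upt_Suc flip: concat_append map_append)
  then have split: "copy (r i) = z i + t i" for i
    by (simp add: copy_def z_def t_def vec_at_append)
  have t_small: "norm (t i) \<le> K * (1/2) ^ i" for i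
  proof -
    have "norm (t i) \<le> 2 * K * ((1/2) ^ Suc i - (1/2) ^ Suc (r i))"
      unfolding t_def by (rule tail_small) (use ri[of i] in simp)
    also have "\<dots> \<le> 2 * K * (1/2) ^ Suc i" using K_ge_1 by (intro mult_left_mono) auto
    finally show ?thesis by simp
  qed
  have tails: "summable (\<lambda>i. s (c i) (t i))" if M: "\<And>i. norm (c i) \<le> M" for M
  proof (rule summable_norm_le_power)
    fix i
    show "norm (s (c i) (t i)) \<le> (M * K) * (1/2) ^ i"
      unfolding norm_scale mult.assoc using M[of i] t_small[of i]
      by (intro mult_mono) (auto intro: order_trans[OF norm_ge_zero])
  qed
  have gap: "start (r i) + length (map ((*) (c i)) (trunc i)) \<le> start (r (Suc i))" for i
  proof -
    have "start (r i) + length (trunc i) \<le> start (Suc (r i))" by (simp add: start_Suc trunc_r)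
    also have "\<dots> \<le> start (r (Suc i))"
      using r strict_mono_start by (simp add: strict_mono_less_eq Suc_le_eq strict_mono_Suc_iff)
    finally show ?thesis by simp
  qed
  have gap': "start i + length (map ((*) (c i)) (trunc i)) \<le> start (Suc i)" for i
    by (simp add: start_Suc)
  have z_scale: "s (c i) (z i) = vec_at s x (start (r i)) (map ((*) (c i)) (trunc i))" for i
    by (simp add: z_def vec_at_scale)
  have z_iff: "summable (\<lambda>i. s (c i) (copy i)) \<longleftrightarrow> summable (\<lambda>i. s (c i) (z i))"
  proof
    assume "summable (\<lambda>i. s (c i) (copy i))"
    then show "summable (\<lambda>i. s (c i) (z i))"
      by (rule summable_if_sums_dominated[where C = K])
        (simp only: z_scale scale_copy, intro sum_vec_at_le gap gap' minor_refl)
  next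
    assume "summable (\<lambda>i. s (c i) (z i))"
    then show "summable (\<lambda>i. s (c i) (copy i))"
      by (rule summable_if_sums_dominated[where C = K])
        (simp only: z_scale scale_copy, intro sum_vec_at_le gap gap' minor_refl)
  qed
  show ?thesis
  proof
    assume *: "summable (\<lambda>i. s (c i) (copy i))"
    obtain M where "\<And>i. norm (c i) \<le> M" using coeffs_bounded[of c "\<lambda>i. i"] * by blast
    then have "summable (\<lambda>i. s (c i) (z i) + s (c i) (t i))"
      using * z_iff tails by (intro summable_add) auto
    then show "summable (\<lambda>i. s (c i) (copy (r i)))" by (simp add: split bil.add_right)
  next
    assume *: "summable (\<lambda>i. s (c i) (copy (r i)))"
    obtain M where "\<And>i. norm (c i) \<le> M" using coeffs_bounded[OF *] by blast
    then have "summable (\<lambda>i. s (c i) (copy (r i)) - s (c i) (t i))"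
      using * tails by (intro summable_diff) auto
    then show "summable (\<lambda>i. s (c i) (copy i))" by (simp add: split bil.add_right z_iff)
  qed
qed

theorem subsymmetric_copy: "subsymmetric s copy"
proof -
  have "unconditional s copy"
  proof (rule unconditional_if_monotone)
    show "copy n \<noteq> 0" for n
      using copy_bounded_below by (metis norm_zero not_le)
  next
    fix n and b c :: "nat \<Rightarrow> 'k"
    assume le: "\<And>i. i < n \<Longrightarrow> norm (b i) \<le> norm (c i)"
    have "norm (\<Sum>i=0..<n. s (b i) (copy i)) \<le> K * norm (\<Sum>i=0..<n. s (c i) (copy i))"
      unfolding scale_copy
      by (intro sum_vec_at_le minor_map) (auto simp: start_Suc norm_mult le mult_right_mono)
    then show "norm (\<Sum>i<n. s (b i) (copy i)) \<le> K * norm (\<Sum>i<n. s (c i) (copy i))"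
      by (simp add: lessThan_atLeast0)
  qed
  then show ?thesis
    by (auto simp: subsymmetric_def unconditional_def equivalent_sequences_def summable_copy_subseq)
qed

end

section \<open>Products of coefficient lists\<close>

text \<open>
  The Kronecker product, ordered so that \<open>tensor cs as\<close> lists the coordinates of the vector with
  coefficients \<open>cs\<close> with respect to the block basis of consecutive copies of \<open>as\<close>.
\<close>

definition tensor :: "'k::semiring_0 list \<Rightarrow> 'k list \<Rightarrow> 'k list" where
  "tensor cs as = concat (map (\<lambda>c. map ((*) c) as) cs)"

lemma tensor_simps [simp]:
  "tensor [] as = []"
  "tensor (c # cs) as = map ((*) c) as @ tensor cs as"
  "tensor (cs @ ds) as = tensor cs as @ tensor ds as"
  by (simp_all add: tensor_def)

lemma set_tensor: "set (tensor cs as) = {c * a |c a. c \<in> set cs \<and> a \<in> set as}"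
  by (induction cs) auto

lemma tensor_map_mult: "tensor cs (map ((*) (r::'k::comm_semiring_0)) as) = map ((*) r) (tensor cs as)"
  by (induction cs) (auto simp: mult_ac)

lemma map_of_real_tensor:
  "map of_real (tensor cs as) = tensor (map of_real cs) (map of_real as :: 'k::real_algebra_1 list)"
  by (induction cs) auto

lemma minor_map_mult:
  fixes xs ys :: "'k::real_normed_field list"
  shows "minor xs ys \<Longrightarrow> minor (map ((*) c) xs) (map ((*) c) ys)"
  by (induction rule: minor.induct) (auto intro: minor.intros simp: norm_mult mult_left_mono)

context spreading
begin

lemma vec_at_eq_0_iff: "vec_at s x p cs = 0 \<longleftrightarrow> set cs \<subseteq> {0}"
proof
  assume "vec_at s x p cs = 0"
  then show "set cs \<subseteq> {0}" using entry_le[of _ cs p] nonzero by (auto simp: mult_le_0_iff)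
next
  assume "set cs \<subseteq> {0}"
  then show "vec_at s x p cs = 0" by (induction cs arbitrary: p) auto
qed

lemma vec_at_tensor:
  "vec_at s x p (tensor cs as) = (\<Sum>i<length cs. vec_at s x (p + i * length as) (map ((*) (cs ! i)) as))"
proof (induction cs arbitrary: p)
  case (Cons c cs)
  show ?case
    by (simp add: vec_at_append Cons.IH sum.lessThan_Suc_shift add.assoc del: sum.lessThan_Suc)
qed simp

lemma dominates_finite_sums:
  assumes "dominates s x s y"
  obtains D where "D \<ge> 0" "\<And>b n. norm (\<Sum>i<n. s (b i) (y i)) \<le> D * norm (\<Sum>i<n. s (b i) (x i))"
proof -
  obtain S D where add: "\<And>v w. v \<in> closed_span s x \<Longrightarrow> w \<in> closed_span s x \<Longrightarrow> S (v + w) = S v + S w"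
    and scl: "\<And>c v. v \<in> closed_span s x \<Longrightarrow> S (s c v) = s c (S v)"
    and D: "\<And>v. v \<in> closed_span s x \<Longrightarrow> norm (S v) \<le> D * norm v" and Sx: "\<And>n. S (x n) = y n"
    using assms unfolding dominates_def by blast
  have cl: "v \<in> closed_span s x" if "v \<in> vs.span (range x)" for v
    using that closure_subset unfolding closed_span_def by blast
  have x: "x i \<in> closed_span s x" for i
    by (intro cl vs.span_base) simp
  have sx: "s c (x i) \<in> closed_span s x" for c i
    by (intro cl vs.span_scale vs.span_base) simp
  have sum: "(\<Sum>i<n. s (b i) (x i)) \<in> closed_span s x" for b n
    by (intro cl vs.span_sum vs.span_scale vs.span_base) simp
  have "S (0::'b) = 0" using scl[of "x 0" 0] x by simp
  then have "S (\<Sum>i<n. s (b i) (x i)) = (\<Sum>i<n. s (b i) (y i))" for b n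
    by (induction n) (simp_all add: add x sx sum scl Sx)
  then have "norm (\<Sum>i<n. s (b i) (y i)) \<le> D * norm (\<Sum>i<n. s (b i) (x i))" for b n
    using D[OF sum, of b n] by simp
  then have "norm (\<Sum>i<n. s (b i) (y i)) \<le> \<bar>D\<bar> * norm (\<Sum>i<n. s (b i) (x i))" for b n
    by (rule order_trans) (simp add: mult_right_mono)
  then show ?thesis using that[of "\<bar>D\<bar>"] by simp
qed

text \<open>
  A failure of uniformity, by factors \<open>4 ^ k\<close>, is collected in one sequence of blocks: the violating
  lists are scaled to norm \<open>(1/2) ^ k\<close>, which still leaves a violation by \<open>2 ^ k\<close>, and the growing
  copies built from them cannot be dominated.
\<close>

theorem tensor_upper_bound:
  assumes dom: "\<And>y. block_basis s x y \<Longrightarrow> subsymmetric s y \<Longrightarrow> dominates s x s y"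
  shows "\<exists>C. \<forall>cs as. norm (vec_at s x 0 (tensor cs as)) \<le> C * norm (vec_at s x 0 cs) * norm (vec_at s x 0 as)"
proof (rule ccontr)
  assume unbdd: "\<not> ?thesis"
  have "\<exists>cs as. norm (vec_at s x 0 (tensor cs as)) > 4 ^ k * norm (vec_at s x 0 cs) * norm (vec_at s x 0 as)" for k :: nat
    using unbdd not_le by blast
  then obtain c a where ca: "\<And>k. norm (vec_at s x 0 (tensor (c k) (a k))) >
      4 ^ k * norm (vec_at s x 0 (c k)) * norm (vec_at s x 0 (a k))"
    by metis
  have a_pos: "norm (vec_at s x 0 (a k)) > 0" for k
  proof (rule ccontr)
    assume "\<not> ?thesis"
    then have "set (tensor (c k) (a k)) \<subseteq> {0}" by (auto simp: vec_at_eq_0_iff set_tensor)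
    then have "vec_at s x 0 (tensor (c k) (a k)) = 0" by (simp add: vec_at_eq_0_iff)
    with ca[of k] \<open>\<not> ?thesis\<close> show False by simp
  qed
  define \<rho> where "\<rho> k = (1/2) ^ k / norm (vec_at s x 0 (a k))" for k
  define A where "A k = map ((*) (of_real (\<rho> k))) (a k)" for k
  have \<rho>: "\<rho> k > 0" for k using a_pos by (simp add: \<rho>_def)
  have A_norm: "norm (vec_at s x 0 (A k)) = (1/2) ^ k" for k
  proof -
    have "norm (vec_at s x 0 (A k)) = \<rho> k * norm (vec_at s x 0 (a k))"
      using \<rho>[of k] by (simp add: A_def vec_at_scale norm_scale)
    also have "\<dots> = (1/2) ^ k"
      using a_pos[of k] by (simp add: \<rho>_def)
    finally show ?thesis .
  qed
  then have "vec_at s x 0 (A 0) \<noteq> 0" by (metis norm_zero power_0 zero_neq_one)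
  then interpret growing_copies s x K A
    by unfold_locales (auto simp: A_norm vec_at_eq_0_iff)
  obtain D where "D \<ge> 0" and D: "\<And>b n. norm (\<Sum>i<n. s (b i) (copy i)) \<le> D * norm (\<Sum>i<n. s (b i) (x i))"
    using dominates_finite_sums[OF dom[OF block_basis_copy subsymmetric_copy]] by blast
  \<comment> \<open>The copies from the \<open>k\<close>-th on contain \<open>A k\<close>, so the \<open>k\<close>-th violation is seen by the shifted
    coefficients \<open>c k\<close>.\<close>
  have "2 ^ k < K ^ 3 * D" for k
  proof -
    define l where "l = length (c k)"
    define b where "b i = (replicate k 0 @ c k) ! i" for i
    have lst: "map b [0..<k + l] = replicate k 0 @ c k"
      unfolding b_def l_def by (intro nth_equalityI) auto
    have "norm (vec_at s x 0 (tensor (c k) (A k))) \<le> K * norm (vec_at s x 0 (tensor (replicate k 0 @ c k) (A k)))"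
      by (intro minor_le) (simp add: minor_append_left minor_refl)
    also have "vec_at s x 0 (tensor (replicate k 0 @ c k) (A k)) =
        (\<Sum>i=0..<k+l. vec_at s x (i * length (A k)) (map ((*) (b i)) (A k)))"
      by (simp add: vec_at_tensor l_def b_def lessThan_atLeast0 del: tensor_simps)
    also have "K * norm \<dots> \<le> K * (K * norm (\<Sum>i=0..<k+l. s (b i) (copy i)))"
      unfolding scale_copy
    proof (intro mult_left_mono sum_vec_at_le)
      fix i assume "i < k + l"
      show "minor (map ((*) (b i)) (A k)) (map ((*) (b i)) (trunc i))"
      proof (cases "i < k")
        case True
        then have "map ((*) (b i)) (A k) = replicate (length (A k)) 0"
          by (intro nth_equalityI) (auto simp: b_def nth_append)
        then show ?thesis by (simp add: minor_replicate_zero)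
      next
        case False
        then have "[0..<Suc i] = [0..<k] @ k # [Suc k..<Suc i]"
          using upt_add_eq_append[of 0 k "Suc i - k"] upt_conv_Cons[of k "Suc i"] by simp
        then have "trunc i = concat (map A [0..<k]) @ A k @ concat (map A [Suc k..<Suc i])"
          by (simp only: trunc_def map_append concat_append list.map concat.simps)
        then have "minor (A k) (trunc i)"
          by (simp only: minor_append_left minor_append_right minor_refl)
        then show ?thesis by (rule minor_map_mult)
      qed
    qed (use K_ge_1 in \<open>simp_all add: start_Suc\<close>)
    also have "\<dots> \<le> K * (K * (D * norm (\<Sum>i<k+l. s (b i) (x i))))"
      using K_ge_1 D[of b "k + l"] by (intro mult_left_mono) (simp_all add: lessThan_atLeast0)
    also have "(\<Sum>i<k+l. s (b i) (x i)) = vec_at s x 0 (replicate k 0 @ c k)"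
      unfolding lst[symmetric] vec_at_map_upt ..
    also have "K * (K * (D * norm \<dots>)) \<le> K * (K * (D * (K * norm (vec_at s x 0 (c k)))))"
      using K_ge_1 \<open>D \<ge> 0\<close>
      by (intro mult_left_mono minor_le minor_append[OF minor_replicate_zero, of "c k" "c k" k "[]", simplified] minor_refl) auto
    finally have up: "norm (vec_at s x 0 (tensor (c k) (A k))) \<le> K ^ 3 * D * norm (vec_at s x 0 (c k))"
      by (simp add: power3_eq_cube mult_ac)
    have "\<rho> k * (4 ^ k * norm (vec_at s x 0 (c k)) * norm (vec_at s x 0 (a k))) < \<rho> k * norm (vec_at s x 0 (tensor (c k) (a k)))"
      using ca[of k] \<rho>[of k] by simp
    also have "\<dots> = norm (vec_at s x 0 (tensor (c k) (A k)))"
      using \<rho>[of k] by (simp add: A_def tensor_map_mult vec_at_scale norm_scale)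
    also have "\<rho> k * (4 ^ k * norm (vec_at s x 0 (c k)) * norm (vec_at s x 0 (a k))) = (1/2) ^ k * 4 ^ k * norm (vec_at s x 0 (c k))"
      using a_pos[of k] by (simp add: \<rho>_def)
    also have "(1/2) ^ k * 4 ^ k = (2::real) ^ k"
      by (simp flip: power_mult_distrib)
    finally have "2 ^ k * norm (vec_at s x 0 (c k)) < K ^ 3 * D * norm (vec_at s x 0 (c k))"
      using up by simp
    then show ?thesis by (simp add: mult_less_cancel_right)
  qed
  moreover obtain k where "K ^ 3 * D < 2 ^ k"
    using real_arch_pow[of 2 "K ^ 3 * D"] by auto
  ultimately show False by (metis less_asym)
qed

end

section \<open>Norming functionals on finite lists\<close>

text \<open>
  \<open>A\<close> is the graph of a linear functional of norm at most 1, and \<open>g\<close> the value of an extension at \<open>u\<close>.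
  Presenting the functional by its graph spares the choice of coordinates on its domain: the bound on
  \<open>r\<close> already forces \<open>r\<close> to be determined by \<open>w\<close>.
\<close>

lemma hahn_banach_step:
  fixes A :: "('b::real_normed_vector \<times> real) set"
  assumes A: "subspace A" and le: "\<And>w r. (w, r) \<in> A \<Longrightarrow> r \<le> norm w"
  shows "\<exists>g. \<forall>(w, r)\<in>A. \<forall>t. r + t * g \<le> norm (w + t *\<^sub>R u)"
proof -
  have add: "(w + w', r + r') \<in> A" if "(w, r) \<in> A" "(w', r') \<in> A" for w w' r r'
    using subspace_add[OF A that] by simp
  have scl: "(c *\<^sub>R w, c * r) \<in> A" if "(w, r) \<in> A" for c w r
    using subspace_scale[OF A that, of c] by simp
  define L where "L = {r - norm (w - u) |w r. (w, r) \<in> A}"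
  have cross: "r - norm (w - u) \<le> norm (w' + u) - r'" if "(w, r) \<in> A" "(w', r') \<in> A" for w w' r r'
    using le[OF add[OF that]] norm_triangle_ineq[of "w - u" "w' + u"] by simp
  have "(0, 0) \<in> A" using subspace_0[OF A] by (simp add: zero_prod_def)
  have "bdd_above L"
    unfolding L_def bdd_above_def using cross[OF _ \<open>(0, 0) \<in> A\<close>] by blast
  then have lower: "r - norm (w - u) \<le> Sup L" if "(w, r) \<in> A" for w r
    using that by (intro cSup_upper) (auto simp: L_def)
  have upper: "Sup L \<le> norm (w' + u) - r'" if "(w', r') \<in> A" for w' r'
    using \<open>(0, 0) \<in> A\<close> cross[OF _ that] by (intro cSup_least) (auto simp: L_def)
  have "r + t * Sup L \<le> norm (w + t *\<^sub>R u)" if wr: "(w, r) \<in> A" for w r t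
  proof -
    consider "t = 0" | "t > 0" | "t < 0" by linarith
    then show ?thesis
    proof cases
      case 1
      then show ?thesis using le[OF wr] by simp
    next
      case 2
      have "t * Sup L \<le> t * (norm ((1 / t) *\<^sub>R w + u) - (1 / t) * r)"
        using upper[OF scl[OF wr, of "1 / t"]] 2 by (intro mult_left_mono) auto
      also have "\<dots> = norm (t *\<^sub>R ((1 / t) *\<^sub>R w + u)) - r"
        using 2 by (simp add: right_diff_distrib)
      also have "t *\<^sub>R ((1 / t) *\<^sub>R w + u) = w + t *\<^sub>R u"
        using 2 by (simp add: scaleR_right_distrib)
      finally show ?thesis by simp
    next
      case 3
      define z where "z = (1 / - t) *\<^sub>R w - u"
      have "w + t *\<^sub>R u = (- t) *\<^sub>R z"
        using 3 by (simp add: z_def scaleR_right_diff_distrib)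
      then have "norm (w + t *\<^sub>R u) = (- t) * norm z"
        using 3 by simp
      moreover have "(- t) * ((1 / - t) * r - norm z) \<le> (- t) * Sup L"
        using lower[OF scl[OF wr, of "1 / - t"]] 3 by (intro mult_left_mono) (auto simp: z_def)
      then have "r - (- t) * norm z \<le> (- t) * Sup L"
        using 3 by (simp add: right_diff_distrib)
      ultimately show ?thesis by simp
    qed
  qed
  then show ?thesis by blast
qed

text \<open>The functional is extended from the line through \<open>v\<close> by one vector at a time.\<close>

lemma norming_coefficients:
  fixes u :: "nat \<Rightarrow> 'b::real_normed_vector" and \<alpha> :: "nat \<Rightarrow> real"
  obtains g where "\<And>t. (\<Sum>i<m. g i * t i) \<le> norm (\<Sum>i<m. t i *\<^sub>R u i)"
    "norm (\<Sum>i<m. \<alpha> i *\<^sub>R u i) \<le> (\<Sum>i<m. g i * \<alpha> i)"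
proof -
  define v where "v = (\<Sum>i<m. \<alpha> i *\<^sub>R u i)"
  have "\<exists>g. \<forall>l t. l * norm v + (\<Sum>i<n. g i * t i) \<le> norm (l *\<^sub>R v + (\<Sum>i<n. t i *\<^sub>R u i))" for n
  proof (induction n)
    case 0
    have "l * norm v \<le> norm (l *\<^sub>R v)" for l by (simp add: mult_right_mono)
    then show ?case by simp
  next
    case (Suc n)
    then obtain g where g: "\<And>l t. l * norm v + (\<Sum>i<n. g i * t i) \<le> norm (l *\<^sub>R v + (\<Sum>i<n. t i *\<^sub>R u i))"
      by blast
    define A where "A = {(l *\<^sub>R v + (\<Sum>i<n. t i *\<^sub>R u i), l * norm v + (\<Sum>i<n. g i * t i)) |l t. True}"
    have "subspace A"
    proof (rule subspaceI)
      show "0 \<in> A"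
        unfolding A_def by (force simp: zero_prod_def intro: exI[of _ 0] exI[of _ "\<lambda>_. 0"])
    next
      fix a b assume "a \<in> A" "b \<in> A"
      then obtain l t l' t' where
        "a = (l *\<^sub>R v + (\<Sum>i<n. t i *\<^sub>R u i), l * norm v + (\<Sum>i<n. g i * t i))"
        "b = (l' *\<^sub>R v + (\<Sum>i<n. t' i *\<^sub>R u i), l' * norm v + (\<Sum>i<n. g i * t' i))"
        unfolding A_def by blast
      then have "a + b = ((l + l') *\<^sub>R v + (\<Sum>i<n. (t i + t' i) *\<^sub>R u i), (l + l') * norm v + (\<Sum>i<n. g i * (t i + t' i)))"
        by (simp add: algebra_simps sum.distrib)
      then show "a + b \<in> A"
        unfolding A_def mem_Collect_eq
        by (intro exI[of _ "l + l'"] exI[of _ "\<lambda>i. t i + t' i"]) simp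
    next
      fix c a assume "a \<in> A"
      then obtain l t where
        "a = (l *\<^sub>R v + (\<Sum>i<n. t i *\<^sub>R u i), l * norm v + (\<Sum>i<n. g i * t i))"
        unfolding A_def by blast
      then have "c *\<^sub>R a = ((c * l) *\<^sub>R v + (\<Sum>i<n. (c * t i) *\<^sub>R u i), (c * l) * norm v + (\<Sum>i<n. g i * (c * t i)))"
        by (simp add: algebra_simps scaleR_sum_right sum_distrib_left)
      then show "c *\<^sub>R a \<in> A"
        unfolding A_def mem_Collect_eq
        by (intro exI[of _ "c * l"] exI[of _ "\<lambda>i. c * t i"]) simp
    qed
    then have "\<exists>\<gamma>. \<forall>(w, r)\<in>A. \<forall>t. r + t * \<gamma> \<le> norm (w + t *\<^sub>R u n)"
      by (rule hahn_banach_step) (auto simp: A_def g)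
    then obtain \<gamma> where \<gamma>: "\<And>w r \<tau>. (w, r) \<in> A \<Longrightarrow> r + \<tau> * \<gamma> \<le> norm (w + \<tau> *\<^sub>R u n)" by blast
    have "l * norm v + (\<Sum>i<n. g i * t i) + t n * \<gamma> \<le> norm (l *\<^sub>R v + (\<Sum>i<n. t i *\<^sub>R u i) + t n *\<^sub>R u n)" for l t
      by (rule \<gamma>) (auto simp: A_def)
    then show ?case
      by (intro exI[of _ "g(n := \<gamma>)"]) (simp add: algebra_simps)
  qed
  then obtain g where g: "\<And>l t. l * norm v + (\<Sum>i<m. g i * t i) \<le> norm (l *\<^sub>R v + (\<Sum>i<m. t i *\<^sub>R u i))"
    by blast
  show ?thesis
  proof (rule that)
    show "(\<Sum>i<m. g i * t i) \<le> norm (\<Sum>i<m. t i *\<^sub>R u i)" for t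
      using g[of 0 t] by simp
    show "norm (\<Sum>i<m. \<alpha> i *\<^sub>R u i) \<le> (\<Sum>i<m. g i * \<alpha> i)"
      using g[of 1 "\<lambda>i. - \<alpha> i"] by (simp add: v_def sum_negf)
  qed
qed

abbreviation pairing :: "'k::semiring_0 list \<Rightarrow> 'k list \<Rightarrow> 'k" where
  "pairing gs cs \<equiv> sum_list (map2 (*) gs cs)"

lemma pairing_map_mult:
  assumes "length bs = length as"
  shows "pairing (map ((*) \<gamma>) bs) (map ((*) c) as) = (\<gamma> * c) * pairing bs (as :: 'k::comm_semiring_0 list)"
  using assms by (induction bs as rule: list_induct2) (auto simp: algebra_simps)

lemma pairing_tensor:
  assumes "length gs = length cs" "length bs = length as"
  shows "pairing (tensor gs bs) (tensor cs as) = pairing gs cs * pairing bs (as :: 'k::comm_semiring_0 list)"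
  using assms(1)
  by (induction gs cs rule: list_induct2) (simp_all add: pairing_map_mult assms(2) algebra_simps)

lemma pairing_conv_sum:
  assumes "length gs = length cs"
  shows "pairing gs cs = (\<Sum>i<length cs. gs ! i * cs ! i)"
  using assms by (simp add: sum_list_sum_nth lessThan_atLeast0)

lemma length_tensor: "length (tensor cs as) = length cs * length as"
  by (induction cs) auto

context subsymmetric_basis
begin

lemma dual_vec_at_pairing:
  assumes "length gs = length cs"
  shows "blinfun_apply (vec_at dual_scale e' 0 gs) (vec_at s e 0 cs) = pairing gs cs"
  by (simp add: dual_vec_at_apply pairing_conv_sum assms functional_vec_at)

text \<open>
  Up to a constant, unconditionality lets us replace the coefficients of a real-linear norming
  functional by their absolute values.
\<close>

lemma nonneg_norming_list:
  obtains K where "\<And>as. (\<And>a. a \<in> set as \<Longrightarrow> a \<ge> 0) \<Longrightarrow>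
    \<exists>bs. length bs = length as \<and> norm (vec_at dual_scale e' 0 (map of_real bs :: 'k list)) \<le> K \<and>
      norm (vec_at s e 0 (map of_real as)) \<le> pairing bs (as :: real list)"
proof -
  obtain K where K0: "K \<ge> 0" and K: "\<And>I \<phi> \<beta> v. finite I \<Longrightarrow> strict_mono_on I \<phi> \<Longrightarrow>
      (\<And>i. i \<in> I \<Longrightarrow> norm (\<beta> i) \<le> 1) \<Longrightarrow>
      norm (\<Sum>i\<in>I. s (\<beta> i * blinfun_apply (e' (\<phi> i)) v) (e i)) \<le> K * norm v"
    using spread_multiplier_bounded by blast
  have "\<exists>bs. length bs = length as \<and> norm (vec_at dual_scale e' 0 (map of_real bs :: 'k list)) \<le> K \<and>
      norm (vec_at s e 0 (map of_real as)) \<le> pairing bs as" if as: "\<And>a. a \<in> set as \<Longrightarrow> a \<ge> 0" for as :: "real list"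
  proof -
    define m where "m = length as"
    obtain g where g: "\<And>t. (\<Sum>i<m. g i * t i) \<le> norm (\<Sum>i<m. t i *\<^sub>R e i)"
      and ga: "norm (\<Sum>i<m. as ! i *\<^sub>R e i) \<le> (\<Sum>i<m. g i * as ! i)"
      by (rule norming_coefficients[where u = e and \<alpha> = "\<lambda>i. as ! i" and m = m]) blast
    define bs where "bs = map (\<lambda>i. \<bar>g i\<bar>) [0..<m]"
    have "norm (vec_at s e 0 (map of_real as)) = norm (\<Sum>i<m. as ! i *\<^sub>R e i)"
      by (simp add: vec_at_conv_sum m_def scale_of_real)
    also have "\<dots> \<le> (\<Sum>i<m. g i * as ! i)" by (rule ga)
    also have "\<dots> \<le> (\<Sum>i<m. bs ! i * as ! i)"
      using as by (intro sum_mono) (auto simp: bs_def m_def intro!: mult_right_mono)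
    also have "\<dots> = pairing bs as" by (simp add: pairing_conv_sum bs_def m_def)
    finally have 1: "norm (vec_at s e 0 (map of_real as)) \<le> pairing bs as" .
    have "norm (vec_at dual_scale e' 0 (map of_real bs :: 'k list)) \<le> K"
    proof (rule norm_blinfun_bound[OF K0])
      fix w
      define z where "z i = blinfun_apply (e' i) w" for i
      define t where "t i = sgn (g i) * norm (z i)" for i
      have "norm (blinfun_apply (vec_at dual_scale e' 0 (map of_real bs)) w) = norm (\<Sum>i<m. of_real \<bar>g i\<bar> * z i)"
        by (simp add: dual_vec_at_apply bs_def z_def)
      also have "\<dots> \<le> (\<Sum>i<m. g i * t i)"
        by (intro sum_norm_le) (simp add: t_def norm_mult abs_sgn)
      also have "\<dots> \<le> norm (\<Sum>i<m. t i *\<^sub>R e i)" by (rule g)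
      also have "(\<Sum>i<m. t i *\<^sub>R e i) = (\<Sum>i<m. s ((of_real (t i) / z i) * z i) (e i))"
        by (intro sum.cong) (auto simp: t_def simp flip: scale_of_real)
      also have "norm \<dots> \<le> K * norm w"
        unfolding z_def[of _]
      proof (rule K)
        show "norm (of_real (t i) / blinfun_apply (e' i) w) \<le> 1" for i
          by (simp add: norm_divide t_def z_def abs_mult sgn_if)
      qed (auto simp: monotone_on_def)
      finally show "norm (blinfun_apply (vec_at dual_scale e' 0 (map of_real bs)) w) \<le> K * norm w" .
    qed
    with 1 show ?thesis by (intro exI[of _ bs]) (simp add: bs_def m_def)
  qed
  then show ?thesis by (rule that)
qed

text \<open>The lower bound is dual to the upper bound for the functionals: test the product of two vectors
  against the product of their norming functionals.\<close>

theorem tensor_lower_bound: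
  assumes upper: "\<And>gs bs. norm (vec_at dual_scale e' 0 (tensor gs bs)) \<le>
    C * norm (vec_at dual_scale e' 0 gs) * norm (vec_at dual_scale e' 0 bs)"
  shows "\<exists>C'. \<forall>cs as. (\<forall>c\<in>set cs. c \<ge> 0) \<longrightarrow> (\<forall>a\<in>set as. a \<ge> 0) \<longrightarrow>
    norm (vec_at s e 0 (map of_real cs)) * norm (vec_at s e 0 (map of_real as)) \<le>
    C' * norm (vec_at s e 0 (map of_real (tensor cs as)))"
proof -
  obtain K where K: "\<And>as. (\<And>a. a \<in> set as \<Longrightarrow> a \<ge> 0) \<Longrightarrow>
    \<exists>bs. length bs = length as \<and> norm (vec_at dual_scale e' 0 (map of_real bs :: 'k list)) \<le> K \<and>
      norm (vec_at s e 0 (map of_real as)) \<le> pairing bs (as :: real list)"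
    using nonneg_norming_list by blast
  have "norm (vec_at s e 0 (map of_real cs)) * norm (vec_at s e 0 (map of_real as)) \<le>
    (\<bar>C\<bar> * K * K) * norm (vec_at s e 0 (map of_real (tensor cs as)))"
    if cs: "\<And>c. c \<in> set cs \<Longrightarrow> c \<ge> 0" and as: "\<And>a. a \<in> set as \<Longrightarrow> a \<ge> 0" for cs as :: "real list"
  proof -
    obtain gs where gs: "length gs = length cs" "norm (vec_at dual_scale e' 0 (map of_real gs :: 'k list)) \<le> K"
      "norm (vec_at s e 0 (map of_real cs)) \<le> pairing gs cs" using K[OF cs] by blast
    obtain bs where bs: "length bs = length as" "norm (vec_at dual_scale e' 0 (map of_real bs :: 'k list)) \<le> K"
      "norm (vec_at s e 0 (map of_real as)) \<le> pairing bs as" using K[OF as] by blast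
    let ?f = "vec_at dual_scale e' 0 (map of_real (tensor gs bs) :: 'k list)"
    let ?v = "vec_at s e 0 (map of_real (tensor cs as))"
    have "norm (vec_at s e 0 (map of_real cs)) * norm (vec_at s e 0 (map of_real as)) \<le> pairing gs cs * pairing bs as"
      using gs(3) bs(3) by (intro mult_mono) (auto intro: order_trans[OF norm_ge_zero])
    also have "\<dots> = pairing (tensor gs bs) (tensor cs as)"
      by (simp add: pairing_tensor gs bs)
    also have "\<dots> \<le> norm (of_real (pairing (tensor gs bs) (tensor cs as)) :: 'k)" by simp
    also have "(of_real (pairing (tensor gs bs) (tensor cs as)) :: 'k) = blinfun_apply ?f ?v"
      by (simp add: dual_vec_at_pairing length_tensor gs(1) bs(1) pairing_conv_sum)
    also have "norm \<dots> \<le> norm ?f * norm ?v" by (rule norm_blinfun)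
    also have "norm ?f \<le> \<bar>C\<bar> * K * K"
    proof -
      have "norm ?f \<le> C * norm (vec_at dual_scale e' 0 (map of_real gs :: 'k list)) * norm (vec_at dual_scale e' 0 (map of_real bs :: 'k list))"
        unfolding map_of_real_tensor by (rule upper)
      also have "\<dots> \<le> \<bar>C\<bar> * K * K"
        using gs(2) bs(2) order_trans[OF norm_ge_zero gs(2)] by (intro mult_mono) auto
      finally show ?thesis .
    qed
    finally show ?thesis by (simp add: mult_right_mono)
  qed
  then show ?thesis by blast
qed

end

section \<open>Multiplicative norms on real lists\<close>

lemma nonpos_if_multiples_bounded:
  fixes a b :: real
  assumes "\<And>k::nat. k \<ge> 1 \<Longrightarrow> real k * a \<le> b"
  shows "a \<le> 0"
proof (rule ccontr)
  assume "\<not> a \<le> 0"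
  then obtain k :: nat where k: "b < real k * a" using reals_Archimedean3[of a] by auto
  then have "real k * a < real (Suc k) * a" using \<open>\<not> a \<le> 0\<close> by (simp add: algebra_simps)
  with k assms[of "Suc k"] show False by simp
qed

text \<open>
  A function that is almost additive with respect to multiplication and almost increasing is within
  bounded distance of a multiple of the logarithm.  Comparing powers \<open>n ^ l \<le> m ^ k < n ^ (l + 1)\<close>
  bounds every \<open>(h m - M) / ln m\<close> by every \<open>(h n + M) / ln n\<close>, so a number in between will do.
\<close>

lemma almost_additive_ln:
  fixes h :: "nat \<Rightarrow> real"
  assumes L: "L \<ge> 0"
    and add: "\<And>m n. m \<ge> 1 \<Longrightarrow> n \<ge> 1 \<Longrightarrow> \<bar>h (m * n) - h m - h n\<bar> \<le> L"
    and mono: "\<And>m n. 1 \<le> m \<Longrightarrow> m \<le> n \<Longrightarrow> h m \<le> h n + L"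
  shows "\<exists>\<theta>\<ge>0. \<forall>n\<ge>1. \<bar>h n - \<theta> * ln (real n)\<bar> \<le> 2 * L"
proof -
  have h1: "\<bar>h 1\<bar> \<le> L" using add[of 1 1] by simp
  have h_lower: "h n \<ge> - 2 * L" if "n \<ge> 1" for n
    using mono[OF order_refl that] h1 by simp
  have pow: "\<bar>h (n ^ k) - real k * h n\<bar> \<le> real k * L" if "n \<ge> 1" "k \<ge> 1" for n k
    using that(2)
  proof (induction k rule: nat_induct_at_least)
    case base
    show ?case using L by simp
  next
    case (Suc k)
    then show ?case using add[of n "n ^ k"] that(1) by (simp add: algebra_simps abs_le_iff)
  qed
  have cross: "(h m - 2 * L) / ln (real m) \<le> (h n + 2 * L) / ln (real n)" if m: "m \<ge> 2" and n: "n \<ge> 2" for m n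
  proof -
    define \<rho> where "\<rho> = ln (real m) / ln (real n)"
    have lnm: "ln (real m) > 0" and lnn: "ln (real n) > 0" using m n by simp_all
    have "h m - L - \<rho> * (h n + 2 * L) \<le> 0"
    proof (rule nonpos_if_multiples_bounded)
      fix k :: nat assume k: "k \<ge> 1"
      obtain l where l: "n ^ l \<le> m ^ k" "m ^ k < n ^ (l + 1)"
        using ex_power_ivl1[OF n, of "m ^ k"] m by auto
      have "real l * ln (real n) \<le> real k * ln (real m)"
      proof -
        have "ln (real (n ^ l)) \<le> ln (real (m ^ k))"
          using l(1) n m by (subst ln_le_cancel_iff) (auto simp flip: of_nat_power)
        then show ?thesis using m n by (simp add: ln_realpow)
      qed
      then have l\<rho>: "real l \<le> real k * \<rho>" using lnn by (simp add: \<rho>_def field_simps)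
      have "real k * h m - real k * L \<le> h (m ^ k)" using pow[of m k] m k by (simp add: abs_le_iff)
      also have "\<dots> \<le> h (n ^ (l + 1)) + L" using l(2) m by (intro mono) auto
      also have "\<dots> \<le> real (l + 1) * h n + real (l + 1) * L + L"
        using pow[of n "l + 1"] n by (simp add: abs_le_iff)
      also have "\<dots> \<le> real (l + 1) * (h n + 2 * L) + L"
        using L by (simp add: algebra_simps)
      also have "\<dots> \<le> (real k * \<rho> + 1) * (h n + 2 * L) + L"
        using l\<rho> h_lower[of n] n by (intro add_right_mono mult_right_mono) auto
      finally show "real k * (h m - L - \<rho> * (h n + 2 * L)) \<le> h n + 2 * L + L"
        by (simp add: algebra_simps)
    qed
    then have "h m - 2 * L \<le> \<rho> * (h n + 2 * L)" using L by simp
    then show ?thesis using lnm lnn by (simp add: \<rho>_def field_simps)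
  qed
  define \<theta> where "\<theta> = (SUP m\<in>{2..}. (h m - 2 * L) / ln (real m))"
  have bdd: "bdd_above ((\<lambda>m. (h m - 2 * L) / ln (real m)) ` {2..})"
    using cross[of _ 2] by (intro bdd_aboveI2[of _ _ "(h 2 + 2 * L) / ln (real 2)"]) auto
  have near: "\<bar>h n - \<theta> * ln (real n)\<bar> \<le> 2 * L" if "n \<ge> 1" for n
  proof (cases "n = 1")
    case True
    then show ?thesis using h1 L by simp
  next
    case False
    then have n: "n \<ge> 2" using that by simp
    have lnn: "ln (real n) > 0" using n by simp
    have "(h n - 2 * L) / ln (real n) \<le> \<theta>"
      unfolding \<theta>_def by (rule cSUP_upper[OF _ bdd]) (use n in simp)
    moreover have "\<theta> \<le> (h n + 2 * L) / ln (real n)"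
      unfolding \<theta>_def by (rule cSUP_least) (use cross n in auto)
    ultimately show ?thesis using lnn by (simp add: abs_le_iff field_simps)
  qed
  have "- \<theta> * ln 2 \<le> 0"
  proof (rule nonpos_if_multiples_bounded)
    fix k :: nat
    show "real k * (- \<theta> * ln 2) \<le> 4 * L"
      using near[of "2 ^ k"] h_lower[of "2 ^ k"] by (simp add: ln_realpow abs_le_iff algebra_simps)
  qed
  then have "\<theta> \<ge> 0" by (simp add: zero_le_mult_iff)
  with near show ?thesis by blast
qed

text \<open>
  If \<open>y < x\<close>, then \<open>(y / x) ^ N\<close> tends to 0 even after multiplication by a linear function of \<open>N\<close>.
\<close>

lemma le_if_powers_le_linear:
  fixes x y a b :: real
  assumes x: "x \<ge> 0" and y: "y \<ge> 0" and le: "\<And>N::nat. x ^ N \<le> (a * real N + b) * y ^ N"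
  shows "x \<le> y"
proof (rule ccontr)
  assume "\<not> x \<le> y"
  then have xy: "y < x" "x > 0" using y by auto
  define q where "q = y / x"
  have q: "0 \<le> q" "q < 1" using xy y by (auto simp: q_def)
  have "1 \<le> a * (real N * q ^ N) + b * q ^ N" for N
  proof -
    have "1 * x ^ N \<le> ((a * real N + b) * q ^ N) * x ^ N"
      using le[of N] xy by (simp add: q_def power_divide)
    then have "1 \<le> (a * real N + b) * q ^ N"
      by (rule mult_right_le_imp_le) (use xy in simp)
    then show ?thesis by (simp add: algebra_simps)
  qed
  moreover have "(\<lambda>N. a * (real N * q ^ N) + b * q ^ N) \<longlonglongrightarrow> a * 0 + b * 0"
    using q by (intro tendsto_intros powser_times_n_limit_0 LIMSEQ_power_zero) auto
  ultimately have "1 \<le> a * 0 + b * 0"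
    by (intro tendsto_lowerbound[where F = sequentially]) auto
  then show False by simp
qed

abbreviation nonneg :: "real list \<Rightarrow> bool" where
  "nonneg xs \<equiv> \<forall>x\<in>set xs. 0 \<le> x"

lemma nonneg_tensor: "nonneg cs \<Longrightarrow> nonneg as \<Longrightarrow> nonneg (tensor cs as)"
  by (auto simp: set_tensor)

lemma minor_indicator:
  "minor (map (\<lambda>y. if y = v then 1 else 0) ys :: real list) (replicate (count_list ys v) 1)"
  "minor (replicate (count_list ys v) 1) (map (\<lambda>y. if y = v then 1 else 0) ys :: real list)"
  by (induction ys) (auto intro: minor.intros)

lemma sum_list_map_count:
  fixes f :: "'a \<Rightarrow> real"
  shows "sum_list (map f xs) = (\<Sum>x\<in>set xs. f x * real (count_list xs x))"
proof -
  have "sum_list (map f xs) = (\<Sum>x\<in>X. f x * real (count_list xs x))" if "set xs \<subseteq> X" "finite X" for X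
    using that(1)
  proof (induction xs)
    case (Cons y ys)
    have "(\<Sum>x\<in>X. f x * real (count_list (y # ys) x)) = (\<Sum>x\<in>X. f x * real (count_list ys x) + (if x = y then f x else 0))"
      by (intro sum.cong) (auto simp: algebra_simps)
    then show ?case using Cons that(2) by (simp add: sum.distrib)
  qed simp
  then show ?thesis by simp
qed

definition powsum :: "real \<Rightarrow> real list \<Rightarrow> real" where
  "powsum p xs = sum_list (map (\<lambda>x. x powr p) xs)"

lemma powsum_nonneg: "powsum p xs \<ge> 0"
  by (auto simp: powsum_def intro!: sum_list_nonneg)

lemma powsum_map_mult: "c \<ge> 0 \<Longrightarrow> nonneg xs \<Longrightarrow> powsum p (map ((*) c) xs) = c powr p * powsum p xs"
  by (induction xs) (auto simp: powsum_def powr_mult algebra_simps)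

lemma powsum_tensor: "nonneg cs \<Longrightarrow> nonneg as \<Longrightarrow> powsum p (tensor cs as) = powsum p cs * powsum p as"
proof (induction cs)
  case (Cons c cs)
  then show ?case using powsum_map_mult[of c as p] by (simp add: powsum_def algebra_simps)
qed (simp add: powsum_def)

lemma powsum_mono:
  assumes "\<And>x. x \<in> set xs \<Longrightarrow> 0 \<le> f x \<and> f x \<le> g x" and "p \<ge> 0"
  shows "powsum p (map f xs) \<le> powsum p (map g xs)"
  using assms by (induction xs) (auto simp: powsum_def intro!: add_mono powr_mono2)

primrec tensor_power :: "real list \<Rightarrow> nat \<Rightarrow> real list" where
  "tensor_power as 0 = [1]"
| "tensor_power as (Suc n) = tensor as (tensor_power as n)"

lemma nonneg_tensor_power: "nonneg as \<Longrightarrow> nonneg (tensor_power as n)"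
proof (induction n)
  case (Suc n)
  then show ?case using nonneg_tensor[of as "tensor_power as n"] by simp
qed simp

lemma powsum_tensor_power: "nonneg as \<Longrightarrow> powsum p (tensor_power as n) = powsum p as ^ n"
  by (induction n) (simp_all add: powsum_tensor nonneg_tensor_power, simp add: powsum_def)

text \<open>
  Products of \<open>N\<close> numbers taken from \<open>dyadic M\<close> take at most \<open>2 * N * M + 2\<close> values: this linear growth
  is the reason for rounding to powers of 2.
\<close>

definition dyadic :: "nat \<Rightarrow> real set" where
  "dyadic M = insert 0 ((\<lambda>k. 2 powr real_of_int k) ` {- int M..int M})"

lemma dyadic_card: "finite (dyadic M)" "card (dyadic M) \<le> 2 * M + 2"
proof -
  have "card ((\<lambda>k. 2 powr real_of_int k) ` {- int M..int M}) \<le> 2 * M + 1"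
    by (rule order_trans[OF card_image_le]) auto
  then show "card (dyadic M) \<le> 2 * M + 2"
    unfolding dyadic_def by (intro order_trans[OF card_insert_le_m1]) auto
qed (simp add: dyadic_def)

lemma dyadic_mult: "a \<in> dyadic M \<Longrightarrow> b \<in> dyadic N \<Longrightarrow> a * b \<in> dyadic (M + N)"
proof (cases "a = 0 \<or> b = 0")
  case False
  assume "a \<in> dyadic M" "b \<in> dyadic N"
  with False obtain k l where "a = 2 powr real_of_int k" "k \<in> {- int M..int M}"
    "b = 2 powr real_of_int l" "l \<in> {- int N..int N}"
    by (auto simp: dyadic_def)
  then have "a * b = 2 powr real_of_int (k + l)" "k + l \<in> {- int (M + N)..int (M + N)}"
    by (auto simp: powr_add)
  then show ?thesis unfolding dyadic_def by blast
qed (auto simp: dyadic_def)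

lemma set_tensor_power_dyadic: "set as \<subseteq> dyadic M \<Longrightarrow> set (tensor_power as N) \<subseteq> dyadic (N * M)"
proof (induction N)
  case 0
  then show ?case by (auto simp: dyadic_def intro!: image_eqI[of _ _ 0])
next
  case (Suc N)
  then show ?case using dyadic_mult[of _ M _ "N * M"] by (auto simp: set_tensor)
qed

text \<open>
  \<open>F\<close> is the norm of the vector with the given real coefficients.  Its multiplicativity is only
  required of non-negative lists, which unconditionality allows the argument to be restricted to.
\<close>

locale multiplicative_norm =
  fixes F :: "real list \<Rightarrow> real" and C :: real
  assumes C1: "C \<ge> 1"
    and F_nonneg: "F xs \<ge> 0"
    and F_one: "F [1] > 0"
    and F_minor: "minor xs ys \<Longrightarrow> F xs \<le> C * F ys"
    and F_scale: "F (map ((*) c) xs) = \<bar>c\<bar> * F xs"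
    and F_add: "F (map (\<lambda>i. f i + g i) [0..<n]) \<le> F (map f [0..<n]) + F (map g [0..<n])"
    and F_tensor_le: "nonneg cs \<Longrightarrow> nonneg as \<Longrightarrow> F (tensor cs as) \<le> C * F cs * F as"
    and F_tensor_ge: "nonneg cs \<Longrightarrow> nonneg as \<Longrightarrow> F cs * F as \<le> C * F (tensor cs as)"
begin

lemma F_zeros: "F (map (\<lambda>_. 0) xs) = 0"
  using F_scale[of 0 "map (\<lambda>_. 0) xs"] by (simp add: o_def)

lemma F_sum:
  assumes "finite V"
  shows "F (map (\<lambda>x. \<Sum>v\<in>V. g v x) zs) \<le> (\<Sum>v\<in>V. F (map (g v) zs))"
  using assms
proof (induction V)
  case (insert v V)
  have nth: "map f zs = map (\<lambda>i. f (zs ! i)) [0..<length zs]" for f :: "'b \<Rightarrow> real"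
    by (intro nth_equalityI) auto
  have "F (map (\<lambda>x. g v x + (\<Sum>v\<in>V. g v x)) zs) \<le> F (map (g v) zs) + F (map (\<lambda>x. \<Sum>v\<in>V. g v x) zs)"
    unfolding nth by (rule F_add)
  with insert show ?case by simp
qed (simp add: F_zeros)

text \<open>
  The fundamental function of the basis.
\<close>

definition fundamental :: "nat \<Rightarrow> real" where
  "fundamental n = F (replicate n 1)"

lemma F_indicator_le: "F (map (\<lambda>y. if y = v then 1 else 0) ys) \<le> C * fundamental (count_list ys v)"
  unfolding fundamental_def by (intro F_minor minor_indicator)

lemma fundamental_le_F_indicator: "fundamental (count_list ys v) \<le> C * F (map (\<lambda>y. if y = v then 1 else 0) ys)"
  unfolding fundamental_def by (intro F_minor minor_indicator)

lemma fundamental_mono: "m \<le> n \<Longrightarrow> fundamental m \<le> C * fundamental n"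
  using minor_append_right[OF minor_refl, of "replicate m 1" "replicate (n - m) (1::real)"]
  unfolding fundamental_def by (intro F_minor) (simp flip: replicate_add)

lemma fundamental_pos:
  assumes "n \<ge> 1"
  shows "fundamental n > 0"
proof -
  have "0 < C * fundamental n" using fundamental_mono[OF assms] F_one by (simp add: fundamental_def)
  then show ?thesis using C1 by (simp add: zero_less_mult_iff)
qed

lemma fundamental_le_linear: "fundamental n \<le> real n * (C * fundamental 1)"
proof -
  have "replicate n 1 = map (\<lambda>i. \<Sum>j<n. if i = j then 1 else (0::real)) [0..<n]"
    by (intro nth_equalityI) auto
  then have "fundamental n \<le> (\<Sum>j<n. F (map (\<lambda>i. if i = j then 1 else 0) [0..<n]))"
    unfolding fundamental_def using F_sum[of "{..<n}" "\<lambda>j i. if i = j then 1 else 0" "[0..<n]"] by simp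
  also have "\<dots> \<le> (\<Sum>j<n. C * fundamental 1)"
  proof (intro sum_mono)
    fix j assume "j \<in> {..<n}"
    moreover have "count_list [0..<n] j = (if j < n then 1 else 0)"
      by (induction n) auto
    ultimately show "F (map (\<lambda>i. if i = j then 1 else 0) [0..<n]) \<le> C * fundamental 1"
      using minor_indicator(1)[of j "[0..<n]"] unfolding fundamental_def by (intro F_minor) simp
  qed
  finally show ?thesis by simp
qed

lemma fundamental_mult: "fundamental (m * n) \<le> C * fundamental m * fundamental n" "fundamental m * fundamental n \<le> C * fundamental (m * n)"
proof -
  have "tensor (replicate m 1) (replicate n 1) = replicate (m * n) (1::real)"
    by (induction m) (simp_all add: replicate_add)
  then show "fundamental (m * n) \<le> C * fundamental m * fundamental n" "fundamental m * fundamental n \<le> C * fundamental (m * n)"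
    unfolding fundamental_def
    using F_tensor_le[of "replicate m 1" "replicate n 1"] F_tensor_ge[of "replicate m 1" "replicate n 1"]
    by simp_all
qed

lemma fundamental_power_type:
  "\<exists>\<theta> D. 0 \<le> \<theta> \<and> \<theta> \<le> 1 \<and> D \<ge> 1 \<and> (\<forall>n\<ge>1. fundamental n \<le> D * real n powr \<theta> \<and> real n powr \<theta> \<le> D * fundamental n)"
proof -
  have C0: "C > 0" using C1 by simp
  have "\<exists>\<theta>\<ge>0. \<forall>n\<ge>1. \<bar>ln (fundamental n) - \<theta> * ln (real n)\<bar> \<le> 2 * ln C"
  proof (rule almost_additive_ln)
    fix m n :: nat assume mn: "m \<ge> 1" "n \<ge> 1"
    then have pos: "fundamental m > 0" "fundamental n > 0" "fundamental (m * n) > 0" by (simp_all add: fundamental_pos)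
    have "ln (fundamental (m * n)) \<le> ln (C * fundamental m * fundamental n)" "ln (fundamental m * fundamental n) \<le> ln (C * fundamental (m * n))"
      using fundamental_mult[of m n] pos C0 by simp_all
    then show "\<bar>ln (fundamental (m * n)) - ln (fundamental m) - ln (fundamental n)\<bar> \<le> ln C"
      using pos C0 by (simp add: ln_mult abs_le_iff)
  next
    fix m n :: nat assume mn: "1 \<le> m" "m \<le> n"
    then have "ln (fundamental m) \<le> ln (C * fundamental n)"
      using fundamental_mono[OF mn(2)] fundamental_pos[of m] by simp
    then show "ln (fundamental m) \<le> ln (fundamental n) + ln C"
      using fundamental_pos[of n] mn C0 by (simp add: ln_mult)
  qed (use C1 in simp)
  then obtain \<theta> where \<theta>: "\<theta> \<ge> 0" and near: "\<And>n. n \<ge> 1 \<Longrightarrow> \<bar>ln (fundamental n) - \<theta> * ln (real n)\<bar> \<le> 2 * ln C"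
    by blast
  define D where "D = exp (2 * ln C)"
  have D1: "D \<ge> 1" using C1 by (simp add: D_def)
  have bounds: "fundamental n \<le> D * real n powr \<theta> \<and> real n powr \<theta> \<le> D * fundamental n" if n: "n \<ge> 1" for n
  proof -
    have "exp (ln (fundamental n)) \<le> exp (2 * ln C + \<theta> * ln (real n))" "exp (\<theta> * ln (real n)) \<le> exp (2 * ln C + ln (fundamental n))"
      using near[OF n] unfolding exp_le_cancel_iff by (simp_all add: abs_le_iff)
    then show ?thesis using fundamental_pos[OF n] n by (simp add: powr_def exp_add D_def)
  qed
  have "(\<theta> - 1) * ln 2 \<le> 0"
  proof (rule nonpos_if_multiples_bounded)
    fix k :: nat
    have "ln (fundamental (2 ^ k)) \<le> ln (real (2 ^ k) * (C * fundamental 1))"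
      using fundamental_le_linear[of "2 ^ k"] fundamental_pos[of "2 ^ k"] by simp
    also have "\<dots> = real k * ln 2 + ln (C * fundamental 1)"
      using C0 fundamental_pos[of 1] by (subst ln_mult_pos) (auto simp: ln_realpow)
    finally show "real k * ((\<theta> - 1) * ln 2) \<le> ln (C * fundamental 1) + 2 * ln C"
      using near[of "2 ^ k"] by (simp add: ln_realpow abs_le_iff algebra_simps)
  qed
  then have "\<theta> \<le> 1" by (simp add: mult_le_0_iff)
  with \<theta> D1 bounds show ?thesis by blast
qed

text \<open>
  A list with few distinct entries is a short combination of multiples of indicators, on which the
  norm is known; comparing the sum with the largest summand costs a factor of their number.
\<close>

lemma F_level_bounds:
  assumes \<theta>: "0 < \<theta>" "\<theta> \<le> 1" and D: "D \<ge> 1"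
    and fundamental: "\<And>n. n \<ge> 1 \<Longrightarrow> fundamental n \<le> D * real n powr \<theta> \<and> real n powr \<theta> \<le> D * fundamental n"
    and xs: "nonneg xs" and V: "card (set xs) \<le> V"
  shows "F xs \<le> (C * D * real V) * powsum (1 / \<theta>) xs powr \<theta>"
    and "powsum (1 / \<theta>) xs powr \<theta> \<le> (D * C * C * real V) * F xs"
proof -
  define p where "p = 1 / \<theta>"
  have p: "p > 0" "p * \<theta> = 1" using \<theta> by (auto simp: p_def)
  define ind where "ind v x = (if x = v then 1 else (0::real))" for v x :: real
  define N where "N v = count_list xs v" for v
  have N: "N v \<ge> 1" if "v \<in> set xs" for v
    using that by (simp add: N_def Suc_le_eq count_list_0_iff flip: neq0_conv)
  have S: "powsum p xs = (\<Sum>v\<in>set xs. v powr p * real (N v))"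
    unfolding powsum_def N_def by (rule sum_list_map_count)
  have term_eq: "(v powr p * real (N v)) powr \<theta> = v * real (N v) powr \<theta>" if "v \<ge> 0" for v
    using that p by (simp add: powr_mult powr_powr)
  have term_le: "v * real (N v) powr \<theta> \<le> powsum p xs powr \<theta>" if v: "v \<in> set xs" for v
  proof -
    have "v powr p * real (N v) \<le> powsum p xs"
      unfolding S by (rule member_le_sum) (use v in auto)
    then have "(v powr p * real (N v)) powr \<theta> \<le> powsum p xs powr \<theta>"
      using \<theta> by (intro powr_mono2) auto
    then show ?thesis using term_eq[of v] v xs by simp
  qed
  have "xs = map (\<lambda>x. \<Sum>v\<in>set xs. v * ind v x) xs"
    by (intro nth_equalityI) (auto simp: ind_def if_distrib cong: if_cong)
  then have "F xs \<le> (\<Sum>v\<in>set xs. F (map (\<lambda>x. v * ind v x) xs))"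
    using F_sum[of "set xs" "\<lambda>v x. v * ind v x" xs] by simp
  also have "\<dots> \<le> (\<Sum>v\<in>set xs. C * D * powsum p xs powr \<theta>)"
  proof (intro sum_mono)
    fix v assume v: "v \<in> set xs"
    then have v0: "v \<ge> 0" using xs by auto
    have "F (map (\<lambda>x. v * ind v x) xs) = v * F (map (ind v) xs)"
      using F_scale[of v "map (ind v) xs"] v0 by (simp add: o_def)
    also have "\<dots> \<le> v * (C * fundamental (N v))"
      unfolding ind_def N_def by (intro mult_left_mono F_indicator_le v0)
    also have "\<dots> \<le> v * (C * (D * real (N v) powr \<theta>))"
      using fundamental[OF N[OF v]] v0 C1 by (intro mult_left_mono) auto
    also have "\<dots> = C * D * (v * real (N v) powr \<theta>)" by simp
    also have "\<dots> \<le> C * D * powsum p xs powr \<theta>"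
      using term_le[OF v] C1 D by (intro mult_left_mono) auto
    finally show "F (map (\<lambda>x. v * ind v x) xs) \<le> C * D * powsum p xs powr \<theta>" .
  qed
  also have "\<dots> \<le> real V * (C * D * powsum p xs powr \<theta>)"
    using V C1 D by (simp add: mult_right_mono)
  finally show "F xs \<le> (C * D * real V) * powsum (1 / \<theta>) xs powr \<theta>" by (simp add: p_def mult_ac)
  define B where "B = D * C * C * F xs"
  have B0: "B \<ge> 0" using C1 D F_nonneg by (simp add: B_def)
  have each: "v powr p * real (N v) \<le> B powr p" if v: "v \<in> set xs" for v
  proof -
    have v0: "v \<ge> 0" using xs v by auto
    have "minor (map (\<lambda>x. v * ind v x) xs) (map (\<lambda>x. x) xs)"
      by (rule minor_map) (auto simp: ind_def)
    then have "F (map (\<lambda>x. v * ind v x) xs) \<le> C * F xs" using F_minor by fastforce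
    then have "v * F (map (ind v) xs) \<le> C * F xs"
      using F_scale[of v "map (ind v) xs"] v0 by (simp add: o_def)
    have "v * real (N v) powr \<theta> \<le> v * (D * fundamental (N v))"
      using fundamental[OF N[OF v]] v0 by (intro mult_left_mono) auto
    also have "\<dots> \<le> v * (D * (C * F (map (ind v) xs)))"
      unfolding ind_def N_def using v0 D by (intro mult_left_mono fundamental_le_F_indicator) auto
    also have "\<dots> = D * C * (v * F (map (ind v) xs))" by simp
    also have "\<dots> \<le> D * C * (C * F xs)"
      using \<open>v * F (map (ind v) xs) \<le> C * F xs\<close> C1 D by (intro mult_left_mono) auto
    finally have "(v * real (N v) powr \<theta>) powr p \<le> B powr p"
      using v0 p by (intro powr_mono2) (auto simp: B_def mult_ac)
    moreover have "(v * real (N v) powr \<theta>) powr p = v powr p * real (N v)"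
      using v0 p by (simp add: powr_mult powr_powr mult.commute)
    ultimately show ?thesis by simp
  qed
  have "powsum p xs \<le> (\<Sum>v\<in>set xs. B powr p)"
    unfolding S by (intro sum_mono each)
  also have "\<dots> \<le> real V * B powr p" using V by (simp add: mult_right_mono)
  finally have "powsum p xs powr \<theta> \<le> (real V * B powr p) powr \<theta>"
    using \<theta> by (intro powr_mono2) (auto simp: powsum_nonneg)
  also have "\<dots> = real V powr \<theta> * B" using B0 p by (simp add: powr_mult powr_powr)
  also have "\<dots> \<le> real V * B"
  proof (intro mult_right_mono B0)
    show "real V powr \<theta> \<le> real V"
    proof (cases "V = 0")
      case False
      then show ?thesis using powr_mono[of \<theta> 1 "real V"] \<theta> by simp
    qed simp
  qed
  finally show "powsum (1 / \<theta>) xs powr \<theta> \<le> (D * C * C * real V) * F xs"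
    by (simp add: p_def B_def mult_ac)
qed

lemma F_tensor_power:
  assumes "nonneg as"
  shows "F (tensor_power as N) \<le> (C * F as) ^ N * F [1]" "F as ^ N * F [1] \<le> C ^ N * F (tensor_power as N)"
proof (induction N)
  case (Suc N)
  have "F (tensor_power as (Suc N)) \<le> C * F as * F (tensor_power as N)"
    using F_tensor_le[OF assms nonneg_tensor_power[OF assms]] by simp
  also have "\<dots> \<le> C * F as * ((C * F as) ^ N * F [1])"
    using Suc(1) C1 F_nonneg by (intro mult_left_mono) auto
  finally show "F (tensor_power as (Suc N)) \<le> (C * F as) ^ Suc N * F [1]" by (simp add: mult_ac)
  have "F as ^ Suc N * F [1] = F as * (F as ^ N * F [1])" by simp
  also have "\<dots> \<le> F as * (C ^ N * F (tensor_power as N))"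
    using Suc(2) F_nonneg by (intro mult_left_mono) auto
  also have "\<dots> = C ^ N * (F as * F (tensor_power as N))" by simp
  also have "\<dots> \<le> C ^ N * (C * F (tensor_power as (Suc N)))"
    using F_tensor_ge[OF assms nonneg_tensor_power[OF assms]] C1 by (intro mult_left_mono) auto
  finally show "F as ^ Suc N * F [1] \<le> C ^ Suc N * F (tensor_power as (Suc N))" by (simp add: mult_ac)
qed simp_all

text \<open>
  Tensor power trick: the norm of the \<open>N\<close>-th power of a dyadic list is known up to a factor that is
  linear in \<open>N\<close> and the \<open>N\<close>-th power of a constant.  After taking \<open>N\<close>-th roots only this constant
  remains.
\<close>

lemma F_dyadic_bounds:
  assumes \<theta>: "0 < \<theta>" "\<theta> \<le> 1" and D: "D \<ge> 1"
    and fundamental: "\<And>n. n \<ge> 1 \<Longrightarrow> fundamental n \<le> D * real n powr \<theta> \<and> real n powr \<theta> \<le> D * fundamental n"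
    and xs: "nonneg xs" and M: "set xs \<subseteq> dyadic M"
  shows "F xs \<le> C * powsum (1 / \<theta>) xs powr \<theta>" and "powsum (1 / \<theta>) xs powr \<theta> \<le> C * F xs"
proof -
  define W where "W = powsum (1 / \<theta>) xs powr \<theta>"
  have card_le: "card (set (tensor_power xs N)) \<le> 2 * (N * M) + 2" for N
    using card_mono[OF dyadic_card(1) set_tensor_power_dyadic[OF M]] dyadic_card(2)[of "N * M"] by (rule order_trans)
  have W_pow: "powsum (1 / \<theta>) (tensor_power xs N) powr \<theta> = W ^ N" for N
    unfolding powsum_tensor_power[OF xs] W_def
    by (induction N) (simp_all add: powr_mult powsum_nonneg)
  note levels = F_level_bounds[OF \<theta> D fundamental nonneg_tensor_power[OF xs] card_le, unfolded W_pow]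
  have "F xs \<le> C * W"
  proof (rule le_if_powers_le_linear)
    fix N
    have "F xs ^ N * F [1] \<le> C ^ N * ((C * D * real (2 * (N * M) + 2)) * W ^ N)"
      using C1 by (intro order_trans[OF F_tensor_power(2)[OF xs]] mult_left_mono levels(1)) auto
    then show "F xs ^ N \<le> ((C * D * 2 * real M / F [1]) * real N + C * D * 2 / F [1]) * (C * W) ^ N"
      using F_one by (simp add: field_simps power_mult_distrib)
  qed (use C1 F_nonneg in \<open>auto simp: W_def\<close>)
  then show "F xs \<le> C * powsum (1 / \<theta>) xs powr \<theta>" by (simp add: W_def)
  have "W \<le> C * F xs"
  proof (rule le_if_powers_le_linear)
    fix N
    have "W ^ N \<le> (D * C * C * real (2 * (N * M) + 2)) * F (tensor_power xs N)"
      by (rule levels(2))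
    also have "\<dots> \<le> (D * C * C * real (2 * (N * M) + 2)) * ((C * F xs) ^ N * F [1])"
      using C1 D by (intro mult_left_mono F_tensor_power(1) xs) auto
    finally show "W ^ N \<le> ((D * C * C * F [1] * 2 * real M) * real N + D * C * C * F [1] * 2) * (C * F xs) ^ N"
      by (simp add: algebra_simps)
  qed (use C1 F_nonneg in \<open>auto simp: W_def\<close>)
  then show "powsum (1 / \<theta>) xs powr \<theta> \<le> C * F xs" by (simp add: W_def)
qed

text \<open>
  Rounding the entries down to powers of 2 changes both norms by bounded factors.
\<close>

lemma F_bounds:
  assumes \<theta>: "0 < \<theta>" "\<theta> \<le> 1" and D: "D \<ge> 1"
    and fundamental: "\<And>n. n \<ge> 1 \<Longrightarrow> fundamental n \<le> D * real n powr \<theta> \<and> real n powr \<theta> \<le> D * fundamental n"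
    and xs: "nonneg xs"
  shows "F xs \<le> 2 * C\<^sup>2 * powsum (1 / \<theta>) xs powr \<theta>" and "powsum (1 / \<theta>) xs powr \<theta> \<le> 2 * C\<^sup>2 * F xs"
proof -
  define d where "d x = (if x = 0 then 0 else 2 powr real_of_int \<lfloor>log 2 x\<rfloor>)" for x :: real
  have d: "0 \<le> d x" "d x \<le> x" "x \<le> 2 * d x" if "x \<ge> 0" for x
  proof -
    show "0 \<le> d x" by (simp add: d_def)
    show "d x \<le> x"
    proof (cases "x = 0")
      case False
      then have "2 powr real_of_int \<lfloor>log 2 x\<rfloor> \<le> 2 powr log 2 x" by (intro powr_mono) auto
      then show ?thesis using False that by (simp add: d_def)
    qed (simp add: d_def)
    show "x \<le> 2 * d x"
    proof (cases "x = 0")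
      case False
      have "x = 2 powr log 2 x" using False that by simp
      also have "\<dots> \<le> 2 powr (real_of_int \<lfloor>log 2 x\<rfloor> + 1)" by (intro powr_mono) linarith+
      also have "\<dots> = 2 * d x" using False by (simp add: d_def powr_add)
      finally show ?thesis .
    qed (simp add: d_def)
  qed
  define ds where "ds = map d xs"
  have ds: "nonneg ds" using xs d by (auto simp: ds_def)
  obtain M where M: "\<forall>n\<in>(\<lambda>x. nat \<bar>\<lfloor>log 2 x\<rfloor>\<bar>) ` set xs. n \<le> M"
    using finite_nat_set_iff_bounded_le[of "(\<lambda>x. nat \<bar>\<lfloor>log 2 x\<rfloor>\<bar>) ` set xs"] by auto
  have "set ds \<subseteq> dyadic M"
  proof
    fix y assume "y \<in> set ds"
    then obtain x where x: "x \<in> set xs" "y = d x" by (auto simp: ds_def)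
    then have "\<lfloor>log 2 x\<rfloor> \<in> {- int M..int M}" using M by auto
    then show "y \<in> dyadic M" using x(2) by (auto simp: d_def dyadic_def)
  qed
  note bounds = F_dyadic_bounds[OF \<theta> D fundamental ds this]
  have "minor ds (map (\<lambda>x. x) xs)" unfolding ds_def using xs d by (intro minor_map) auto
  then have F1: "F ds \<le> C * F xs" using F_minor by fastforce
  have "minor (map (\<lambda>x. x) xs) (map (\<lambda>x. 2 * d x) xs)" using xs d by (intro minor_map) auto
  then have "F xs \<le> C * F (map ((*) 2) ds)" using F_minor by (fastforce simp: ds_def o_def)
  then have F2: "F xs \<le> 2 * C * F ds" by (simp add: F_scale)
  have "powsum (1 / \<theta>) ds \<le> powsum (1 / \<theta>) (map (\<lambda>x. x) xs)"
    unfolding ds_def using xs d \<theta> by (intro powsum_mono) auto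
  then have P1: "powsum (1 / \<theta>) ds powr \<theta> \<le> powsum (1 / \<theta>) xs powr \<theta>"
    using \<theta> by (intro powr_mono2) (auto simp: powsum_nonneg)
  have "powsum (1 / \<theta>) (map (\<lambda>x. x) xs) \<le> powsum (1 / \<theta>) (map (\<lambda>x. 2 * d x) xs)"
    using xs d \<theta> by (intro powsum_mono) auto
  also have "\<dots> = powsum (1 / \<theta>) (map ((*) 2) ds)" by (simp add: ds_def o_def)
  also have "\<dots> = 2 powr (1 / \<theta>) * powsum (1 / \<theta>) ds" using ds by (simp add: powsum_map_mult)
  finally have "powsum (1 / \<theta>) xs powr \<theta> \<le> (2 powr (1 / \<theta>) * powsum (1 / \<theta>) ds) powr \<theta>"
    using \<theta> by (intro powr_mono2) (auto simp: powsum_nonneg)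
  then have P2: "powsum (1 / \<theta>) xs powr \<theta> \<le> 2 * powsum (1 / \<theta>) ds powr \<theta>"
    using \<theta> by (simp add: powr_mult powr_powr powsum_nonneg)
  have "F xs \<le> 2 * C * (C * powsum (1 / \<theta>) xs powr \<theta>)"
    using F2 bounds(1) P1 C1 by (meson order_trans mult_left_mono zero_le_mult_iff zero_le_numeral zero_le_one)
  then show "F xs \<le> 2 * C\<^sup>2 * powsum (1 / \<theta>) xs powr \<theta>" by (simp add: power2_eq_square mult_ac)
  have "powsum (1 / \<theta>) xs powr \<theta> \<le> 2 * (C * (C * F xs))"
    using P2 bounds(2) F1 C1 by (meson order_trans mult_left_mono zero_le_mult_iff zero_le_numeral zero_le_one)
  then show "powsum (1 / \<theta>) xs powr \<theta> \<le> 2 * C\<^sup>2 * F xs" by (simp add: power2_eq_square mult_ac)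
qed

theorem c0_or_lp:
  "(\<exists>D. \<forall>n. F (replicate n 1) \<le> D) \<or>
   (\<exists>p\<ge>1. \<exists>D>0. \<forall>xs. nonneg xs \<longrightarrow>
      F xs \<le> D * powsum p xs powr (1 / p) \<and> powsum p xs powr (1 / p) \<le> D * F xs)"
proof -
  obtain \<theta> D where \<theta>: "0 \<le> \<theta>" "\<theta> \<le> 1" and D: "D \<ge> 1"
    and fundamental: "\<And>n. n \<ge> 1 \<Longrightarrow> fundamental n \<le> D * real n powr \<theta> \<and> real n powr \<theta> \<le> D * fundamental n"
    using fundamental_power_type by blast
  show ?thesis
  proof (cases "\<theta> = 0")
    case True
    have "F (replicate n 1) \<le> D" for n
      using fundamental[of n] True D F_zeros[of "[]"] by (cases "n = 0") (auto simp: fundamental_def)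
    then show ?thesis by blast
  next
    case False
    then have "0 < \<theta>" using \<theta> by simp
    note bounds = F_bounds[OF this \<theta>(2) D fundamental]
    have "1 / \<theta> \<ge> 1" "2 * C\<^sup>2 > 0" using \<open>0 < \<theta>\<close> \<theta> C1 by auto
    with bounds show ?thesis
      by (intro disjI2 exI[of _ "1 / \<theta>"] conjI exI[of _ "2 * C\<^sup>2"]) auto
  qed
qed

end

section \<open>Convergence of unit vector series\<close>

lemma sum_unit_vec: "(\<Sum>j<n. a j * unit_vec j i) = (if i < n then a i else (0::'k::real_normed_field))"
proof -
  have "(\<Sum>j<n. a j * unit_vec j i) = (\<Sum>j<n. if j = i then a j else 0)"
    by (intro sum.cong) (auto simp: unit_vec_def)
  then show ?thesis by simp
qed

text \<open>
  In \<open>c\<^sub>0\<close> and \<open>\<ell>\<^sub>p\<close> the norm dominates every coordinate, so a unit vector series can only converge to its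
  own coefficient sequence.
\<close>

lemma eq_if_close_to_partial_sums:
  fixes a z :: "nat \<Rightarrow> 'k::real_normed_field"
  assumes lim: "N' \<longlonglongrightarrow> 0" and le: "\<And>n i. i < n \<Longrightarrow> norm (a i - z i) \<le> N' n"
  shows "a = z"
proof
  fix i
  have "\<forall>\<^sub>F n in sequentially. norm (a i - z i) \<le> N' n"
    using eventually_gt_at_top[of i] by eventually_elim (rule le)
  then have "norm (a i - z i) \<le> 0"
    using lim by (intro tendsto_lowerbound[where F = sequentially]) auto
  then show "a i = z i" by simp
qed

lemma unit_vec_series_converges_c0_iff:
  fixes a :: "nat \<Rightarrow> 'k::real_normed_field"
  shows "unit_vec_series_converges c0_space c0_norm a \<longleftrightarrow> a \<longlonglongrightarrow> 0"
proof -
  have bdd: "bdd_above (range (\<lambda>i. norm ((if i < n then a i else 0) - z i)))" if z: "z \<longlonglongrightarrow> 0" for z :: "nat \<Rightarrow> 'k" and n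
  proof -
    have "\<forall>\<^sub>F i in sequentially. 0 - z i = (if i < n then a i else 0) - z i"
      using eventually_ge_at_top[of n] by eventually_elim auto
    then have "(\<lambda>i. (if i < n then a i else 0) - z i) \<longlonglongrightarrow> 0 - 0"
      by (rule Lim_transform_eventually[rotated]) (intro tendsto_intros z)
    then have "Bseq (\<lambda>i. (if i < n then a i else 0) - z i)"
      by (intro convergent_imp_Bseq convergentI)
    then obtain B where "\<And>i. norm ((if i < n then a i else 0) - z i) \<le> B"
      unfolding Bseq_def by blast
    then show ?thesis by (rule bdd_aboveI2)
  qed
  show ?thesis
  proof
    assume "unit_vec_series_converges c0_space c0_norm a"
    then obtain z where z: "z \<longlonglongrightarrow> 0" and lim: "(\<lambda>n. c0_norm (\<lambda>i. (if i < n then a i else 0) - z i)) \<longlonglongrightarrow> 0"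
      by (auto simp: unit_vec_series_converges_def c0_space_def sum_unit_vec)
    have "a = z"
    proof (rule eq_if_close_to_partial_sums[OF lim])
      fix n i :: nat assume "i < n"
      then show "norm (a i - z i) \<le> c0_norm (\<lambda>i. (if i < n then a i else 0) - z i)"
        unfolding c0_norm_def using cSUP_upper[OF UNIV_I bdd[OF z, of n], of i] by simp
    qed
    with z show "a \<longlonglongrightarrow> 0" by simp
  next
    assume a: "a \<longlonglongrightarrow> 0"
    have "(\<lambda>n. c0_norm (\<lambda>i. (if i < n then a i else 0) - a i)) \<longlonglongrightarrow> 0"
    proof (rule LIMSEQ_I)
      fix \<epsilon> :: real assume "\<epsilon> > 0"
      then have "\<epsilon> / 2 > 0" by simp
      then obtain M where M: "\<And>i. i \<ge> M \<Longrightarrow> norm (a i) < \<epsilon> / 2"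
        using LIMSEQ_D[OF a \<open>\<epsilon> / 2 > 0\<close>] by auto
      have "norm (c0_norm (\<lambda>i. (if i < n then a i else 0) - a i) - 0) < \<epsilon>" if "n \<ge> M" for n
      proof -
        have "c0_norm (\<lambda>i. (if i < n then a i else 0) - a i) \<le> \<epsilon> / 2"
          unfolding c0_norm_def
        proof (rule cSUP_least)
          fix i
          show "norm ((if i < n then a i else 0) - a i) \<le> \<epsilon> / 2"
            using M[of i] that \<open>\<epsilon> > 0\<close> by (cases "i < n") (auto simp: less_imp_le)
        qed simp
        moreover have "0 \<le> c0_norm (\<lambda>i. (if i < n then a i else 0) - a i)"
          unfolding c0_norm_def using cSUP_upper[OF UNIV_I bdd[OF a, of n], of 0] norm_ge_zero order_trans by blast
        ultimately show ?thesis using \<open>\<epsilon> > 0\<close> by simp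
      qed
      then show "\<exists>no. \<forall>n\<ge>no. norm (c0_norm (\<lambda>i. (if i < n then a i else 0) - a i) - 0) < \<epsilon>" by blast
    qed
    with a show "unit_vec_series_converges c0_space c0_norm a"
      by (auto simp: unit_vec_series_converges_def c0_space_def sum_unit_vec)
  qed
qed

lemma unit_vec_series_converges_lp_iff:
  fixes a :: "nat \<Rightarrow> 'k::real_normed_field"
  assumes p: "p \<ge> 1"
  shows "unit_vec_series_converges (lp_space p) (lp_norm p) a \<longleftrightarrow> summable (\<lambda>i. norm (a i) powr p)"
proof
  assume "unit_vec_series_converges (lp_space p) (lp_norm p) a"
  then obtain z where z: "summable (\<lambda>i. norm (z i) powr p)"
    and lim: "(\<lambda>n. lp_norm p (\<lambda>i. (if i < n then a i else 0) - z i)) \<longlonglongrightarrow> 0"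
    by (auto simp: unit_vec_series_converges_def lp_space_def sum_unit_vec)
  have "a = z"
  proof (rule eq_if_close_to_partial_sums[OF lim])
    fix n i :: nat assume i: "i < n"
    define u where "u i = (if i < n then a i else 0) - z i" for i
    have "\<forall>\<^sub>F i in sequentially. norm (u i) powr p = norm (z i) powr p"
      using eventually_ge_at_top[of n] by eventually_elim (auto simp: u_def)
    then have "summable (\<lambda>i. norm (u i) powr p)" using z by (simp cong: summable_cong)
    then have "sum (\<lambda>i. norm (u i) powr p) {i} \<le> (\<Sum>i. norm (u i) powr p)"
      by (rule sum_le_suminf) auto
    then have "(norm (u i) powr p) powr (1 / p) \<le> lp_norm p u"
      unfolding lp_norm_def using p by (intro powr_mono2) auto
    then have "norm (u i) \<le> lp_norm p u" using p by (simp add: powr_powr)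
    then show "norm (a i - z i) \<le> lp_norm p (\<lambda>i. (if i < n then a i else 0) - z i)"
      using i by (simp add: u_def[abs_def])
  qed
  with z show "summable (\<lambda>i. norm (a i) powr p)" by simp
next
  assume a: "summable (\<lambda>i. norm (a i) powr p)"
  have "lp_norm p (\<lambda>i. (if i < n then a i else 0) - a i) =
      ((\<Sum>i. norm (a i) powr p) - (\<Sum>i<n. norm (a i) powr p)) powr (1 / p)" for n
  proof -
    have "(\<lambda>i. norm (a i) powr p - (if i \<in> {..<n} then norm (a i) powr p else 0)) sums
        ((\<Sum>i. norm (a i) powr p) - (\<Sum>i<n. norm (a i) powr p))"
      by (intro sums_diff summable_sums a sums_If_finite_set) simp
    moreover have "(\<lambda>i. norm (a i) powr p - (if i \<in> {..<n} then norm (a i) powr p else 0)) =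
        (\<lambda>i. norm ((if i < n then a i else 0) - a i) powr p)"
      using p by auto
    ultimately show ?thesis by (simp add: lp_norm_def sums_iff)
  qed
  moreover have "(\<lambda>n. ((\<Sum>i. norm (a i) powr p) - (\<Sum>i<n. norm (a i) powr p)) powr (1 / p)) \<longlonglongrightarrow> 0 powr (1 / p)"
  proof (rule tendsto_powr')
    have "(\<lambda>n. (\<Sum>i. norm (a i) powr p) - (\<Sum>i<n. norm (a i) powr p)) \<longlonglongrightarrow> (\<Sum>i. norm (a i) powr p) - (\<Sum>i. norm (a i) powr p)"
      by (intro tendsto_intros summable_LIMSEQ a)
    then show "(\<lambda>n. (\<Sum>i. norm (a i) powr p) - (\<Sum>i<n. norm (a i) powr p)) \<longlonglongrightarrow> 0" by simp
    show "(0::real) \<noteq> 0 \<or> 0 < 1 / p \<and> (\<forall>\<^sub>F n in sequentially. 0 \<le> (\<Sum>i. norm (a i) powr p) - (\<Sum>i<n. norm (a i) powr p))"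
      using p sum_le_suminf[OF a] by (auto intro!: always_eventually)
  qed auto
  ultimately show "unit_vec_series_converges (lp_space p) (lp_norm p) a"
    using a by (auto simp: unit_vec_series_converges_def lp_space_def sum_unit_vec)
qed

section \<open>The characterization\<close>

context spreading
begin

definition real_norm :: "real list \<Rightarrow> real" where
  "real_norm xs = norm (vec_at s x 0 (map of_real xs))"

lemma vec_at_map_interval: "(\<Sum>i=m..<n. s (a i) (x i)) = vec_at s x m (map a [m..<n])"
proof -
  have "vec_at s x m (map a [m..<n]) = (\<Sum>i=0..<n-m. s (a (m + i)) (x (m + i)))"
    by (simp add: vec_at_conv_sum lessThan_atLeast0)
  also have "\<dots> = (\<Sum>i=m..<n. s (a i) (x i))"
    using sum.shift_bounds_nat_ivl[of "\<lambda>i. s (a i) (x i)" 0 m "n - m"]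
    by (cases "m \<le> n") (simp_all add: add.commute)
  finally show ?thesis ..
qed

lemma sum_le_real_norm: "norm (\<Sum>i=m..<n. s (a i) (x i)) \<le> K * real_norm (map (\<lambda>i. norm (a i)) [m..<n])"
  and real_norm_le_sum: "real_norm (map (\<lambda>i. norm (a i)) [m..<n]) \<le> K * norm (\<Sum>i=m..<n. s (a i) (x i))"
  unfolding vec_at_map_interval real_norm_def by (intro vec_at_le; auto simp: o_def intro!: minor_map)+

lemma coeffs_tendsto_0:
  assumes "summable (\<lambda>n. s (a n) (x n))"
  shows "a \<longlonglongrightarrow> 0"
proof (rule Lim_null_comparison)
  have "(\<lambda>n. K / norm (x 0) * norm (s (a n) (x n))) \<longlonglongrightarrow> K / norm (x 0) * 0"
    by (intro tendsto_intros tendsto_norm_zero summable_LIMSEQ_zero assms)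
  then show "(\<lambda>n. K / norm (x 0) * norm (s (a n) (x n))) \<longlonglongrightarrow> 0" by simp
  show "\<forall>\<^sub>F n in sequentially. norm (a n) \<le> K / norm (x 0) * norm (s (a n) (x n))"
  proof (rule always_eventually, rule allI)
    fix n
    show "norm (a n) \<le> K / norm (x 0) * norm (s (a n) (x n))"
      using entry_le[of "a n" "[a n]" n] nonzero by (simp add: field_simps)
  qed
qed

text \<open>
  By unconditionality, a finite sum is bounded, up to a constant, by its largest coefficient times the
  norm of a sum of equally many basis vectors.
\<close>

lemma equivalent_to_c0:
  assumes D: "\<And>n. real_norm (replicate n 1) \<le> D"
  shows "equivalent_to_unit_vec_basis s x c0_space c0_norm"
  unfolding equivalent_to_unit_vec_basis_def unit_vec_series_converges_c0_iff
proof (intro allI iffI coeffs_tendsto_0)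
  fix a :: "nat \<Rightarrow> 'k" assume a: "a \<longlonglongrightarrow> 0"
  have D0: "D \<ge> 0" using D[of 0] by (simp add: real_norm_def)
  show "summable (\<lambda>n. s (a n) (x n))"
    unfolding summable_Cauchy
  proof (intro allI impI)
    fix \<epsilon> :: real assume "\<epsilon> > 0"
    define \<delta> where "\<delta> = \<epsilon> / (K * (D + 1))"
    have KD: "K * (D + 1) > 0" using K_ge_1 D0 by simp
    have \<delta>: "\<delta> > 0" using \<open>\<epsilon> > 0\<close> KD by (simp add: \<delta>_def)
    obtain M where M: "\<And>i. i \<ge> M \<Longrightarrow> norm (a i) < \<delta>"
      using LIMSEQ_D[OF a \<delta>] by auto
    have "norm (\<Sum>i=m..<n. s (a i) (x i)) < \<epsilon>" if "m \<ge> M" for m n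
    proof -
      have "minor (map a [m..<n]) (map (\<lambda>_. of_real \<delta>) [m..<n])"
        using M that \<delta> by (intro minor_map) (auto simp: less_imp_le)
      then have "norm (\<Sum>i=m..<n. s (a i) (x i)) \<le> K * norm (vec_at s x 0 (map (\<lambda>_. of_real \<delta>) [m..<n]))"
        unfolding vec_at_map_interval by (rule vec_at_le)
      also have "map (\<lambda>_. of_real \<delta>) [m..<n] = map ((*) (of_real \<delta> :: 'k)) (map of_real (replicate (n - m) 1))"
        by (simp add: map_replicate_const)
      also have "norm (vec_at s x 0 \<dots>) = \<delta> * real_norm (replicate (n - m) 1)"
        using \<delta> by (simp only: vec_at_scale norm_scale real_norm_def) simp
      also have "K * \<dots> \<le> K * (\<delta> * D)"
        using D \<delta> K_ge_1 by (intro mult_left_mono) auto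
      also have "\<dots> < K * (\<delta> * (D + 1))"
        using \<delta> K_ge_1 by simp
      also have "\<dots> = \<delta> * (K * (D + 1))" by simp
      also have "\<dots> = \<epsilon>" using KD unfolding \<delta>_def by (metis less_irrefl nonzero_eq_divide_eq)
      finally show ?thesis .
    qed
    then show "\<exists>N. \<forall>m\<ge>N. \<forall>n. norm (\<Sum>i=m..<n. s (a i) (x i)) < \<epsilon>" by blast
  qed
qed

text \<open>
  Both series satisfy the Cauchy criterion simultaneously, because sums over intervals of indices have
  comparable norms.
\<close>

lemma equivalent_to_lp:
  assumes p: "p \<ge> 1" and D: "D > 0"
    and bounds: "\<And>xs. nonneg xs \<Longrightarrow> real_norm xs \<le> D * powsum p xs powr (1 / p) \<and>
      powsum p xs powr (1 / p) \<le> D * real_norm xs"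
  shows "equivalent_to_unit_vec_basis s x (lp_space p) (lp_norm p)"
  unfolding equivalent_to_unit_vec_basis_def unit_vec_series_converges_lp_iff[OF p]
proof (intro allI)
  fix a :: "nat \<Rightarrow> 'k"
  define S where "S m n = (\<Sum>i=m..<n. norm (a i) powr p)" for m n
  define v where "v m n = (\<Sum>i=m..<n. s (a i) (x i))" for m n
  define E where "E = K * D"
  have E: "E > 0" using K_ge_1 D by (simp add: E_def)
  have S0: "S m n \<ge> 0" for m n by (simp add: S_def sum_nonneg)
  have S_eq: "powsum p (map (\<lambda>i. norm (a i)) [m..<n]) = S m n" for m n
    by (simp add: powsum_def S_def o_def interv_sum_list_conv_sum_set_nat)
  have b: "real_norm (map (\<lambda>i. norm (a i)) [m..<n]) \<le> D * S m n powr (1 / p)"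
      "S m n powr (1 / p) \<le> D * real_norm (map (\<lambda>i. norm (a i)) [m..<n])" for m n
    using bounds[of "map (\<lambda>i. norm (a i)) [m..<n]"] by (simp_all add: S_eq)
  have up: "norm (v m n) \<le> E * S m n powr (1 / p)" for m n
  proof -
    have "norm (v m n) \<le> K * (D * S m n powr (1 / p))"
      unfolding v_def using K_ge_1
      by (intro order_trans[OF sum_le_real_norm] mult_left_mono b(1)) auto
    then show ?thesis by (simp add: E_def)
  qed
  have low: "S m n powr (1 / p) \<le> E * norm (v m n)" for m n
  proof -
    have "S m n powr (1 / p) \<le> D * (K * norm (v m n))"
      unfolding v_def using D
      by (intro order_trans[OF b(2)] mult_left_mono real_norm_le_sum) auto
    then show ?thesis by (simp add: E_def mult_ac)
  qed
  show "summable (\<lambda>n. s (a n) (x n)) \<longleftrightarrow> summable (\<lambda>i. norm (a i) powr p)"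
  proof
    assume sm: "summable (\<lambda>n. s (a n) (x n))"
    show "summable (\<lambda>i. norm (a i) powr p)"
      unfolding summable_Cauchy
    proof (intro allI impI)
      fix \<epsilon> :: real assume "\<epsilon> > 0"
      then have "\<epsilon> powr (1 / p) / E > 0" using E by simp
      then obtain N where N: "\<And>m n. m \<ge> N \<Longrightarrow> norm (v m n) < \<epsilon> powr (1 / p) / E"
        using sm unfolding summable_Cauchy v_def by blast
      have "norm (S m n) < \<epsilon>" if "m \<ge> N" for m n
      proof -
        have "S m n powr (1 / p) < \<epsilon> powr (1 / p)"
          using low[of m n] N[OF that, of n] E by (simp add: pos_less_divide_eq mult.commute)
        then have "\<not> \<epsilon> \<le> S m n"
          using powr_mono2[of "1 / p" \<epsilon> "S m n"] \<open>\<epsilon> > 0\<close> p by auto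
        then show ?thesis using S0[of m n] by simp
      qed
      then show "\<exists>N. \<forall>m\<ge>N. \<forall>n. norm (\<Sum>i=m..<n. norm (a i) powr p) < \<epsilon>"
        unfolding S_def by blast
    qed
  next
    assume sm: "summable (\<lambda>i. norm (a i) powr p)"
    show "summable (\<lambda>n. s (a n) (x n))"
      unfolding summable_Cauchy
    proof (intro allI impI)
      fix \<epsilon> :: real assume "\<epsilon> > 0"
      then have "(\<epsilon> / E) powr p > 0" using E by simp
      then obtain N where N: "\<And>m n. m \<ge> N \<Longrightarrow> norm (S m n) < (\<epsilon> / E) powr p"
        using sm unfolding summable_Cauchy S_def by blast
      have "norm (v m n) < \<epsilon>" if "m \<ge> N" for m n
      proof -
        have "S m n powr (1 / p) < ((\<epsilon> / E) powr p) powr (1 / p)"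
          using N[OF that, of n] S0[of m n] p by (intro powr_less_mono2) auto
        also have "\<dots> = \<epsilon> / E" using \<open>\<epsilon> > 0\<close> E p by (simp add: powr_powr)
        finally have "E * S m n powr (1 / p) < \<epsilon>" using E by (simp add: pos_less_divide_eq mult.commute)
        with up[of m n] show ?thesis by simp
      qed
      then show "\<exists>N. \<forall>m\<ge>N. \<forall>n. norm (\<Sum>i=m..<n. s (a i) (x i)) < \<epsilon>"
        unfolding v_def by blast
    qed
  qed
qed

lemma multiplicative_norm_real_norm:
  assumes up: "\<And>cs as. norm (vec_at s x 0 (tensor cs as)) \<le> C1 * norm (vec_at s x 0 cs) * norm (vec_at s x 0 as)"
    and low: "\<And>cs as. nonneg cs \<Longrightarrow> nonneg as \<Longrightarrow>
      norm (vec_at s x 0 (map of_real cs)) * norm (vec_at s x 0 (map of_real as)) \<le>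
      C2 * norm (vec_at s x 0 (map of_real (tensor cs as)))"
  shows "multiplicative_norm real_norm (max K (max C1 C2))"
proof
  show "max K (max C1 C2) \<ge> 1" using K_ge_1 by simp
  show "real_norm xs \<ge> 0" for xs by (simp add: real_norm_def)
  show "real_norm [1] > 0" using nonzero by (simp add: real_norm_def)
  show "real_norm xs \<le> max K (max C1 C2) * real_norm ys" if "minor xs ys" for xs ys
  proof -
    have "real_norm xs \<le> K * real_norm ys"
      unfolding real_norm_def by (intro minor_le minor_map_of_real that)
    also have "\<dots> \<le> max K (max C1 C2) * real_norm ys"
      by (intro mult_right_mono) (auto simp: real_norm_def)
    finally show ?thesis .
  qed
  show "real_norm (map ((*) c) xs) = \<bar>c\<bar> * real_norm xs" for c xs
  proof -
    have "map of_real (map ((*) c) xs) = map ((*) (of_real c :: 'k)) (map of_real xs)" by simp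
    then show ?thesis by (simp only: real_norm_def vec_at_scale norm_scale norm_of_real)
  qed
  show "real_norm (map (\<lambda>i. f i + g i) [0..<n]) \<le> real_norm (map f [0..<n]) + real_norm (map g [0..<n])"
    for f g n
    unfolding real_norm_def map_map o_def vec_at_map_upt
    by (simp add: bil.add_left sum.distrib norm_triangle_ineq)
  show "real_norm (tensor cs as) \<le> max K (max C1 C2) * real_norm cs * real_norm as" for cs as
  proof -
    have "real_norm (tensor cs as) \<le> C1 * (real_norm cs * real_norm as)"
      unfolding real_norm_def map_of_real_tensor using up by (simp add: mult.assoc)
    also have "\<dots> \<le> max K (max C1 C2) * (real_norm cs * real_norm as)"
      by (intro mult_right_mono) (auto simp: real_norm_def)
    finally show ?thesis by (simp add: mult.assoc)
  qed
  show "real_norm cs * real_norm as \<le> max K (max C1 C2) * real_norm (tensor cs as)"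
    if "nonneg cs" "nonneg as" for cs as
  proof -
    have "real_norm cs * real_norm as \<le> C2 * real_norm (tensor cs as)"
      unfolding real_norm_def by (rule low[OF that])
    also have "\<dots> \<le> max K (max C1 C2) * real_norm (tensor cs as)"
      by (intro mult_right_mono) (auto simp: real_norm_def)
    finally show ?thesis .
  qed
qed

end

theorem theorem14:
  fixes s :: "'k::{real_normed_field, euclidean_space} \<Rightarrow> 'a::banach \<Rightarrow> 'a"
    and e :: "nat \<Rightarrow> 'a"
    and e' :: "nat \<Rightarrow> 'a \<Rightarrow>\<^sub>L 'k"
  assumes scaling: "normed_scaling s"
    and basis: "schauder_basis s e"
    and subsymm: "subsymmetric s e"
    and dual: "\<And>i. e' i \<in> dual_space s"
    and biorthogonal: "\<And>i j. blinfun_apply (e' i) (e j) = (if i = j then 1 else 0)"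
    and dom: "\<And>y. block_basis s e y \<Longrightarrow> subsymmetric s y \<Longrightarrow> dominates s e s y"
    and dom_dual: "\<And>g. block_basis dual_scale e' g \<Longrightarrow> subsymmetric dual_scale g
                     \<Longrightarrow> dominates dual_scale e' dual_scale g"
  shows "equivalent_to_unit_vec_basis s e c0_space c0_norm \<or>
         (\<exists>p\<ge>1. equivalent_to_unit_vec_basis s e (lp_space p) (lp_norm p))"
proof -
  interpret subsymmetric_basis s e e'
    by unfold_locales (use assms in auto)
  obtain K where "spreading s e K" and dual_spreading: "spreading dual_scale e' K"
    using spreading_with_dual by blast
  then interpret spreading s e K by simp
  obtain C1 where "\<And>cs as. norm (vec_at s e 0 (tensor cs as)) \<le> C1 * norm (vec_at s e 0 cs) * norm (vec_at s e 0 as)"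
    using tensor_upper_bound[OF dom] by blast
  moreover obtain C where "\<And>gs bs. norm (vec_at dual_scale e' 0 (tensor gs bs)) \<le>
      C * norm (vec_at dual_scale e' 0 gs) * norm (vec_at dual_scale e' 0 bs)"
    using spreading.tensor_upper_bound[OF dual_spreading dom_dual] by blast
  then obtain C2 where "\<And>cs as. nonneg cs \<Longrightarrow> nonneg as \<Longrightarrow>
      norm (vec_at s e 0 (map of_real cs)) * norm (vec_at s e 0 (map of_real as)) \<le>
      C2 * norm (vec_at s e 0 (map of_real (tensor cs as)))"
    using tensor_lower_bound by blast
  ultimately interpret F: multiplicative_norm real_norm "max K (max C1 C2)"
    by (rule multiplicative_norm_real_norm)
  from F.c0_or_lp show ?thesis
  proof
    assume "\<exists>D. \<forall>n. real_norm (replicate n 1) \<le> D"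
    then show ?thesis using equivalent_to_c0 by blast
  next
    assume "\<exists>p\<ge>1. \<exists>D>0. \<forall>xs. nonneg xs \<longrightarrow>
      real_norm xs \<le> D * powsum p xs powr (1 / p) \<and> powsum p xs powr (1 / p) \<le> D * real_norm xs"
    then show ?thesis using equivalent_to_lp by blast
  qed
qed

end
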